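(* The $M$-vertex-stabilizer problem on weighted, capacitated graphs can be solved in polynomial time. That is, there is a polynomial-time algorithm which, given a graph $G=(V,E)$ with edge weights $w\in\mathbb{R}_{\geq 0}^E$, vertex capacities $c\in\mathbb{Z}_{\geq 0}^V$, and a maximum-weight $c$-matching $M$ of $G$, either outputs a minimum-cardinality set $S\subseteq V$ such that $G\setminus S$ is stable and $M$ is a $c$-matching of $G\setminus S$, or correctly determines that no such set exists.
   Context: A $c$-matching of $G=(V,E)$ with capacities $c\in\mathbb{Z}_{\geq0}^V$ is a set $M\subseteq E$ such that every vertex $v$ is incident to at most $c_v$ edges of $M$. For edge weights $w\geq 0$, $\nu^c(G)$ denotes the maximum weight $w(M)=\sum_{e\in M}w_e$ of a $c$-matching, and $\nu_f^c(G):=\max\{w^\top x : \sum_{u: uv\in E}x_{uv}\leq c_v\ \forall v\in V,\ 0\leq x\leq 1\}$. The graph (with its weights and capacities) is called stable if $\nu^c(G)=\nu_f^c(G)$. For $S\subseteq V$, $G\setminus S$ denotes the subgraph induced by $V\setminus S$ (with inherited weights and capacities). A set $S$ with $G\setminus S$ stable is a vertex-stabilizer; it preserves $M$ if $M$ is a $c$-matching in $G\setminus S$ (i.e., $S$ contains no endpoint of an edge of $M$). The $M$-vertex-stabilizer problem asks, given $(G,w,c)$ and a maximum-weight $c$-matching $M$, for a minimum-cardinality vertex-stabilizer among those preserving $M$. *)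

theory Defs
  imports "HOL-Analysis.Analysis" "HOL-Library.Log_Nat" "HOL-Computational_Algebra.Polynomial"
begin

section \<open>Capacitated matchings and stability\<close>

definition simple_graph :: "'a set \<Rightarrow> 'a set set \<Rightarrow> bool" where
  "simple_graph V E \<longleftrightarrow> finite V \<and> (\<forall>e\<in>E. e \<subseteq> V \<and> card e = 2)"

definition c_matching :: "'a set \<Rightarrow> 'a set set \<Rightarrow> ('a \<Rightarrow> nat) \<Rightarrow> 'a set set \<Rightarrow> bool" where
  "c_matching V E c M \<longleftrightarrow> M \<subseteq> E \<and> (\<forall>v\<in>V. card {e \<in> M. v \<in> e} \<le> c v)"

definition nu :: "'a set \<Rightarrow> 'a set set \<Rightarrow> ('a set \<Rightarrow> real) \<Rightarrow> ('a \<Rightarrow> nat) \<Rightarrow> real" where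
  "nu V E w c = Max {(\<Sum>e\<in>M. w e) | M. c_matching V E c M}"

definition fractional_c_matching ::
  "'a set \<Rightarrow> 'a set set \<Rightarrow> ('a \<Rightarrow> nat) \<Rightarrow> ('a set \<Rightarrow> real) \<Rightarrow> bool" where
  "fractional_c_matching V E c x \<longleftrightarrow>
     (\<forall>v\<in>V. (\<Sum>e | e \<in> E \<and> v \<in> e. x e) \<le> real (c v)) \<and> (\<forall>e\<in>E. 0 \<le> x e \<and> x e \<le> 1)"

text \<open>The supremum is a maximum for finite graphs, see \<open>nu_f_attained\<close> below.\<close>

definition nu_f :: "'a set \<Rightarrow> 'a set set \<Rightarrow> ('a set \<Rightarrow> real) \<Rightarrow> ('a \<Rightarrow> nat) \<Rightarrow> real" where
  "nu_f V E w c = Sup {(\<Sum>e\<in>E. w e * x e) | x. fractional_c_matching V E c x}"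

lemma nu_f_attained:
  assumes "simple_graph V E"
  shows "\<exists>x. fractional_c_matching V E c x \<and> nu_f V E w c = (\<Sum>e\<in>E. w e * x e)
     \<and> (\<forall>y. fractional_c_matching V E c y \<longrightarrow> (\<Sum>e\<in>E. w e * y e) \<le> (\<Sum>e\<in>E. w e * x e))"
proof -
  define f where "f = (\<lambda>x::'a set \<Rightarrow> real. \<Sum>e\<in>E. w e * x e)"
  define B where "B = (PiE UNIV (\<lambda>e. if e \<in> E then {0..1} else {0}) :: ('a set \<Rightarrow> real) set)"
  define K where "K = B \<inter> (\<Inter>v\<in>V. {x. (\<Sum>e | e \<in> E \<and> v \<in> e. x e) \<le> real (c v)})"
  have "compactin (product_topology (\<lambda>i. euclidean) UNIV) B"
    unfolding B_def compactin_PiE by auto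
  then have "compact B"
    by (simp add: euclidean_product_topology)
  moreover have "closed (\<Inter>v\<in>V. {x::'a set \<Rightarrow> real. (\<Sum>e | e \<in> E \<and> v \<in> e. x e) \<le> real (c v)})"
    by (intro closed_INT ballI closed_Collect_le continuous_intros
          continuous_on_product_coordinates)
  ultimately have "compact K"
    unfolding K_def by (rule compact_Int_closed)
  moreover have "(\<lambda>e. 0) \<in> K"
    by (auto simp: K_def B_def)
  then have "K \<noteq> {}"
    by blast
  moreover have "continuous_on K f"
    unfolding f_def
    by (intro continuous_intros continuous_on_subset[OF continuous_on_product_coordinates]) auto
  ultimately have "\<exists>x\<in>K. \<forall>y\<in>K. f y \<le> f x"
    by (rule continuous_attains_sup)
  then obtain x where x: "x \<in> K" and mx: "\<And>y. y \<in> K \<Longrightarrow> f y \<le> f x"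
    by blast
  have fx: "fractional_c_matching V E c x"
    unfolding fractional_c_matching_def
  proof (intro conjI ballI)
    fix v assume "v \<in> V"
    then show "(\<Sum>e | e \<in> E \<and> v \<in> e. x e) \<le> real (c v)"
      using x by (simp add: K_def)
  next
    fix e assume "e \<in> E"
    moreover have "x e \<in> (if e \<in> E then {0..1} else {0})"
      using x by (simp add: K_def B_def PiE_iff)
    ultimately show "0 \<le> x e" "x e \<le> 1"
      by simp_all
  qed
  have ub: "f y \<le> f x" if y: "fractional_c_matching V E c y" for y
  proof -
    define z where "z = (\<lambda>e. if e \<in> E then y e else 0)"
    have "(\<Sum>e | e \<in> E \<and> v \<in> e. z e) = (\<Sum>e | e \<in> E \<and> v \<in> e. y e)" for v
      by (rule sum.cong) (auto simp: z_def)
    then have "z \<in> K"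
      using y by (auto simp: K_def B_def z_def fractional_c_matching_def)
    moreover have "f z = f y"
      unfolding f_def by (rule sum.cong) (auto simp: z_def)
    ultimately show ?thesis
      using mx by metis
  qed
  have "nu_f V E w c = f x"
    unfolding nu_f_def f_def[symmetric] using fx ub
    by (intro cSup_eq_maximum) (auto simp: f_def)
  then show ?thesis
    using fx ub unfolding f_def by blast
qed

definition stable :: "'a set \<Rightarrow> 'a set set \<Rightarrow> ('a set \<Rightarrow> real) \<Rightarrow> ('a \<Rightarrow> nat) \<Rightarrow> bool" where
  "stable V E w c \<longleftrightarrow> nu V E w c = nu_f V E w c"

definition max_weight_c_matching ::
  "'a set \<Rightarrow> 'a set set \<Rightarrow> ('a set \<Rightarrow> real) \<Rightarrow> ('a \<Rightarrow> nat) \<Rightarrow> 'a set set \<Rightarrow> bool" where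
  "max_weight_c_matching V E w c M \<longleftrightarrow> c_matching V E c M \<and> (\<Sum>e\<in>M. w e) = nu V E w c"

definition induced_edges :: "'a set set \<Rightarrow> 'a set \<Rightarrow> 'a set set" where
  "induced_edges E U = {e \<in> E. e \<subseteq> U}"

definition vertex_stabilizer ::
  "'a set \<Rightarrow> 'a set set \<Rightarrow> ('a set \<Rightarrow> real) \<Rightarrow> ('a \<Rightarrow> nat) \<Rightarrow> 'a set \<Rightarrow> bool" where
  "vertex_stabilizer V E w c S \<longleftrightarrow>
     S \<subseteq> V \<and> stable (V - S) (induced_edges E (V - S)) w c"

definition M_vertex_stabilizer ::
  "'a set \<Rightarrow> 'a set set \<Rightarrow> ('a set \<Rightarrow> real) \<Rightarrow> ('a \<Rightarrow> nat) \<Rightarrow> 'a set set \<Rightarrow> 'a set \<Rightarrow> bool" where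
  "M_vertex_stabilizer V E w c M S \<longleftrightarrow>
     vertex_stabilizer V E w c S \<and> c_matching (V - S) (induced_edges E (V - S)) c M"

definition min_M_vertex_stabilizer ::
  "'a set \<Rightarrow> 'a set set \<Rightarrow> ('a set \<Rightarrow> real) \<Rightarrow> ('a \<Rightarrow> nat) \<Rightarrow> 'a set set \<Rightarrow> 'a set \<Rightarrow> bool" where
  "min_M_vertex_stabilizer V E w c M S \<longleftrightarrow>
     M_vertex_stabilizer V E w c M S \<and>
     (\<forall>T. M_vertex_stabilizer V E w c M T \<longrightarrow> card S \<le> card T)"


section \<open>Machine model\<close>

text \<open>
  A structured random access machine whose memory consists of arrays of natural numbers and
  arrays of real numbers, addressed by a fixed array name and a computed index; a scalar is a cell
  of an array.  The arithmetic is restricted to addition, (truncated) subtraction and comparison,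
  there are no real constants other than 0 and there is no conversion between the two sorts.
  Every assignment and every test costs one unit; expressions have a fixed size in a given program,
  so this is the unit-cost measure up to a constant factor.

  Because there is no multiplication, bit lengths grow by at most a constant per step.  Hence unit
  cost is polynomially related to Turing machine time on integers, and, for rational weights, a
  polynomial bound on the cost implies a polynomial bound in the bit model.
\<close>

datatype nexp =
    NConst nat
  | NCell nat nexp
  | NAdd nexp nexp
  | NSub nexp nexp

datatype rexp =
    RZero
  | RCell nat nexp
  | RAdd rexp rexp
  | RSub rexp rexp

datatype bexp =
    NLess nexp nexp
  | RLess rexp rexp
  | BNot bexp
  | BAnd bexp bexp

datatype com =
    Skip
  | NAssign nat nexp nexp
  | RAssign nat nexp rexp
  | Seq com com
  | Cond bexp com com
  | While bexp com

type_synonym state = "(nat \<Rightarrow> nat \<Rightarrow> nat) \<times> (nat \<Rightarrow> nat \<Rightarrow> real)"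

fun nval :: "nexp \<Rightarrow> state \<Rightarrow> nat" where
  "nval (NConst k) s = k"
| "nval (NCell a i) s = fst s a (nval i s)"
| "nval (NAdd x y) s = nval x s + nval y s"
| "nval (NSub x y) s = nval x s - nval y s"

fun rval :: "rexp \<Rightarrow> state \<Rightarrow> real" where
  "rval RZero s = 0"
| "rval (RCell a i) s = snd s a (nval i s)"
| "rval (RAdd x y) s = rval x s + rval y s"
| "rval (RSub x y) s = rval x s - rval y s"

fun bval :: "bexp \<Rightarrow> state \<Rightarrow> bool" where
  "bval (NLess x y) s \<longleftrightarrow> nval x s < nval y s"
| "bval (RLess x y) s \<longleftrightarrow> rval x s < rval y s"
| "bval (BNot b) s \<longleftrightarrow> \<not> bval b s"
| "bval (BAnd b b') s \<longleftrightarrow> bval b s \<and> bval b' s"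

definition upd :: "(nat \<Rightarrow> nat \<Rightarrow> 'b) \<Rightarrow> nat \<Rightarrow> nat \<Rightarrow> 'b \<Rightarrow> nat \<Rightarrow> nat \<Rightarrow> 'b" where
  "upd m a i x = m(a := (m a)(i := x))"

text \<open>\<open>exec p s t s'\<close>: started in \<open>s\<close>, the program \<open>p\<close> halts in \<open>s'\<close> after \<open>t\<close> steps.\<close>

inductive exec :: "com \<Rightarrow> state \<Rightarrow> nat \<Rightarrow> state \<Rightarrow> bool" where
  exec_Skip: "exec Skip s 1 s"
| exec_NAssign: "exec (NAssign a i x) s 1 (upd (fst s) a (nval i s) (nval x s), snd s)"
| exec_RAssign: "exec (RAssign a i x) s 1 (fst s, upd (snd s) a (nval i s) (rval x s))"
| exec_Seq: "exec p s t s' \<Longrightarrow> exec q s' t' s'' \<Longrightarrow> exec (Seq p q) s (t + t') s''"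
| exec_CondT: "bval b s \<Longrightarrow> exec p s t s' \<Longrightarrow> exec (Cond b p q) s (t + 1) s'"
| exec_CondF: "\<not> bval b s \<Longrightarrow> exec q s t s' \<Longrightarrow> exec (Cond b p q) s (t + 1) s'"
| exec_WhileF: "\<not> bval b s \<Longrightarrow> exec (While b p) s 1 s"
| exec_WhileT: "bval b s \<Longrightarrow> exec p s t s' \<Longrightarrow> exec (While b p) s' t' s'' \<Longrightarrow>
    exec (While b p) s (t + t' + 1) s''"

inductive_cases exec_SkipE: "exec Skip s t s'"
inductive_cases exec_NAssignE: "exec (NAssign a i x) s t s'"
inductive_cases exec_RAssignE: "exec (RAssign a i x) s t s'"
inductive_cases exec_SeqE: "exec (Seq p q) s t s'"
inductive_cases exec_CondE: "exec (Cond b p q) s t s'"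
inductive_cases exec_WhileE: "exec (While b p) s t s'"

lemma exec_deterministic:
  "exec p s t s' \<Longrightarrow> exec p s u r \<Longrightarrow> u = t \<and> r = s'"
proof (induction arbitrary: u r rule: exec.induct)
  case exec_Skip
  then show ?case by (auto elim: exec_SkipE)
next
  case exec_NAssign
  then show ?case by (auto elim: exec_NAssignE)
next
  case exec_RAssign
  then show ?case by (auto elim: exec_RAssignE)
next
  case (exec_Seq p s t s' q t' s'')
  from exec_Seq.prems obtain t1 s1 t2 where
    "exec p s t1 s1" "exec q s1 t2 r" "u = t1 + t2"
    by (rule exec_SeqE)
  then show ?case using exec_Seq.IH by metis
next
  case (exec_CondT b s p t s' q)
  from exec_CondT.prems exec_CondT.hyps obtain t1 where "exec p s t1 r" "u = t1 + 1"
    by (auto elim: exec_CondE)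
  then show ?case using exec_CondT.IH by metis
next
  case (exec_CondF b s q t s' p)
  from exec_CondF.prems exec_CondF.hyps obtain t1 where "exec q s t1 r" "u = t1 + 1"
    by (auto elim: exec_CondE)
  then show ?case using exec_CondF.IH by metis
next
  case (exec_WhileF b s p)
  from exec_WhileF.prems exec_WhileF.hyps show ?case by (auto elim: exec_WhileE)
next
  case (exec_WhileT b s p t s' t' s'')
  from exec_WhileT.prems exec_WhileT.hyps(1) obtain t1 s1 t2 where
    "exec p s t1 s1" "exec (While b p) s1 t2 r" "u = t1 + t2 + 1"
    by (auto elim: exec_WhileE)
  then show ?case using exec_WhileT.IH by metis
qed


section \<open>Encoding of instances\<close>

text \<open>
  Vertices are natural numbers (arbitrary labels).  A graph is presented to the machine by a list
  of its vertices and a list of its edges, both without repetition and in arbitrary order; an edge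
  is given by its two endpoints, again in arbitrary order.
\<close>

definition uedge :: "'a \<times> 'a \<Rightarrow> 'a set" where
  "uedge p = {fst p, snd p}"

definition represents ::
  "'a list \<Rightarrow> ('a \<times> 'a) list \<Rightarrow> 'a set \<Rightarrow> 'a set set \<Rightarrow> bool" where
  "represents vs es V E \<longleftrightarrow>
     distinct vs \<and> set vs = V \<and> distinct (map uedge es) \<and> set (map uedge es) = E"

definition array_of :: "'b::zero list \<Rightarrow> nat \<Rightarrow> 'b" where
  "array_of xs i = (if i < length xs then xs ! i else 0)"

text \<open>
  Natural number arrays: 0 holds the numbers of vertices and edges, 1 the vertices, 2 their
  capacities, 3 and 4 the endpoints of the edges, 5 the indicator of \<open>M\<close>.  Real array 0 holds the
  edge weights.  All other cells are 0.
\<close>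

definition init_state ::
  "nat list \<Rightarrow> (nat \<times> nat) list \<Rightarrow> (nat set \<Rightarrow> real) \<Rightarrow> (nat \<Rightarrow> nat) \<Rightarrow> nat set set \<Rightarrow> state" where
  "init_state vs es w c M =
     ((\<lambda>_ _. 0)
        (0 := array_of [length vs, length es],
         1 := array_of vs,
         2 := array_of (map c vs),
         3 := array_of (map fst es),
         4 := array_of (map snd es),
         5 := array_of (map (\<lambda>p. of_bool (uedge p \<in> M)) es)),
      (\<lambda>_ _. 0)
        (0 := array_of (map (\<lambda>p. w (uedge p)) es)))"

text \<open>
  The number of memory cells of the input up to a constant factor, plus the binary lengths of all
  integers in it.  Each real weight counts as a single unit.
\<close>

definition input_size :: "nat list \<Rightarrow> (nat \<times> nat) list \<Rightarrow> (nat \<Rightarrow> nat) \<Rightarrow> nat" where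
  "input_size vs es c =
     (\<Sum>v\<leftarrow>vs. 1 + floorlog 2 v + floorlog 2 (c v)) +
     (\<Sum>p\<leftarrow>es. 1 + floorlog 2 (fst p) + floorlog 2 (snd p))"

text \<open>
  Cell 0 of array 6 tells whether a solution exists, array 7 holds the indicator of the solution
  with respect to the order of the vertices in the input.
\<close>

definition output_found :: "state \<Rightarrow> bool" where
  "output_found s \<longleftrightarrow> fst s 6 0 \<noteq> 0"

definition output_set :: "nat list \<Rightarrow> state \<Rightarrow> nat set" where
  "output_set vs s = {vs ! i | i. i < length vs \<and> fst s 7 i \<noteq> 0}"

end

theory Submission
  imports Defs
begin

text \<open>
  A maximum-weight \<open>c\<close>-matching \<open>M\<close> stays maximum in \<open>G \ S\<close> when \<open>S\<close> avoids it, so \<open>G \ S\<close> is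
  stable iff \<open>M\<close> is an optimal fractional \<open>c\<close>-matching there.  Lifting \<open>M\<close> to the bipartite double
  cover turns this into optimality of a flow: \<open>M\<close> is optimal iff the residual digraph has no closed
  walk of positive gain.

  A vertex exposed by \<open>M\<close> is adjacent in the residual digraph to the root in such a way that a
  simple closed walk meets at most two exposed vertices.  If it meets two, then either it repeats no
  edge and augments \<open>M\<close>, which is impossible, or it uses an edge in both directions and can be
  rearranged, using the symmetry of the double cover, into two closed walks that meet one exposed
  vertex each and have twice its gain in total.  Hence the exposed vertices \<open>v\<close> for which the covered
  vertices together with \<open>v\<close> alone admit a closed walk of positive gain form the least stabilizer,
  unless already the covered vertices admit such a walk and there is none.  Each test is one run of
  the Bellman-Ford algorithm, which only adds and compares weights.
\<close>

section \<open>Walks of positive gain and label correction\<close>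

text \<open>Destroying all gainful closed walks by deleting exposed vertices is a priori a hitting
  set problem. It is tractable because a minimal obstruction contains at most one exposed vertex,
  which leaves no choice. The double cover makes linear programming duality work on a non-bipartite
  graph: the average of a potential and its mirror image (with negated values) is a dual solution
  for \<open>G\<close> itself. The price is that a walk in the cover may use both lifts of an edge;
  this changes the edge by two, which means nothing for integral matchings. Exposed vertices are
  peripheral because no matching edge meets them: \<open>Pos v\<close> can be entered only from
  \<open>Root\<close>, and \<open>Neg v\<close> can be left only towards
  \<open>Root\<close>.\<close>

type_synonym 'n arc = "'n \<times> real \<times> 'n"

fun walk :: "'n arc set \<Rightarrow> 'n \<Rightarrow> 'n arc list \<Rightarrow> 'n \<Rightarrow> bool" where
  "walk A x [] y \<longleftrightarrow> x = y"
| "walk A x (a # p) y \<longleftrightarrow> a \<in> A \<and> fst a = x \<and> walk A (snd (snd a)) p y"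

definition gain :: "'n arc list \<Rightarrow> real" where
  "gain p = (\<Sum>a\<leftarrow>p. fst (snd a))"

definition no_gainful_cycle :: "'n arc set \<Rightarrow> bool" where
  "no_gainful_cycle A \<longleftrightarrow> (\<forall>x p. walk A x p x \<longrightarrow> gain p \<le> 0)"

text \<open>Feasible labels in the longest-path convention. Along a closed walk they telescope, so
  they certify that no closed walk gains.\<close>

definition potential :: "'n arc set \<Rightarrow> ('n \<Rightarrow> real) \<Rightarrow> bool" where
  "potential A f \<longleftrightarrow> (\<forall>(x, g, y)\<in>A. f x + g \<le> f y)"

lemma gain_simps [simp]:
  "gain [] = 0" "gain (a # p) = fst (snd a) + gain p" "gain (p @ q) = gain p + gain q"
  by (simp_all add: gain_def)

lemma walk_append: "walk A x (p @ q) y \<longleftrightarrow> (\<exists>z. walk A x p z \<and> walk A z q y)"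
  by (induction p arbitrary: x) auto

lemma walk_arcs: "walk A x p y \<Longrightarrow> set p \<subseteq> A"
  by (induction p arbitrary: x) auto

lemma walk_mono: "walk A x p y \<Longrightarrow> set p \<subseteq> B \<Longrightarrow> walk B x p y"
  by (induction p arbitrary: x) auto

lemma walk_nodes: "walk A x p y \<Longrightarrow> map fst p @ [y] = x # map (snd \<circ> snd) p"
  by (induction p arbitrary: x) auto

lemma no_gainful_cycle_mono: "no_gainful_cycle B \<Longrightarrow> A \<subseteq> B \<Longrightarrow> no_gainful_cycle A"
  unfolding no_gainful_cycle_def using walk_arcs walk_mono by (metis subset_trans)

lemma potential_walk: "potential A f \<Longrightarrow> walk A x p y \<Longrightarrow> f x + gain p \<le> f y"
proof (induction p arbitrary: x)
  case (Cons a p)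
  then have "f x + fst (snd a) \<le> f (snd (snd a))"
    by (auto simp: potential_def case_prod_beta)
  moreover have "f (snd (snd a)) + gain p \<le> f y"
    using Cons by simp
  ultimately show ?case by simp
qed simp

lemma potential_no_gainful_cycle: "potential A f \<Longrightarrow> no_gainful_cycle A"
  unfolding no_gainful_cycle_def using potential_walk by fastforce

lemma walk_split_repeated_node:
  assumes "walk A x p y" "\<not> distinct (x # map (snd \<circ> snd) p)"
  obtains p1 p2 p3 z where "p = p1 @ p2 @ p3" "p2 \<noteq> []"
    "walk A x p1 z" "walk A z p2 z" "walk A z p3 y"
  using assms
proof (induction p arbitrary: x thesis)
  case (Cons a p)
  show ?case
  proof (cases "distinct (snd (snd a) # map (snd \<circ> snd) p)")
    case False
    then obtain p1 p2 p3 z where *: "p = p1 @ p2 @ p3" "p2 \<noteq> []"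
      "walk A (snd (snd a)) p1 z" "walk A z p2 z" "walk A z p3 y"
      using Cons.IH[OF _ _ False] Cons.prems(2) walk.simps(2) by metis
    show ?thesis
      using Cons.prems(2) * by (intro Cons.prems(1)[of "a # p1" p2 p3 z]) auto
  next
    case True
    then have "x \<in> (snd \<circ> snd) ` set (a # p)"
      using Cons.prems(3) by (auto simp: comp_def)
    then obtain b where b: "b \<in> set (a # p)" "snd (snd b) = x"
      unfolding image_iff comp_def by metis
    then obtain q r where qr: "a # p = q @ b # r"
      by (meson split_list)
    with Cons.prems(2) b have "walk A x (q @ [b]) x \<and> walk A x r y"
      by (auto simp: walk_append)
    then show ?thesis
      using qr by (intro Cons.prems(1)[of "[]" "q @ [b]" r x]) auto
  qed
qed simp

text \<open>A walk with more than \<open>k\<close> arcs visits more nodes than \<open>X\<close> has,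
  so it contains a closed part; as that part does not gain, cutting it out loses nothing.\<close>

lemma walk_shorten:
  assumes npc: "no_gainful_cycle A" and X: "finite X" "\<forall>(x, g, y)\<in>A. x \<in> X \<and> y \<in> X"
    and "card X \<le> Suc k" and "walk A x p y"
  obtains q where "walk A x q y" "gain p \<le> gain q" "length q \<le> k"
  using \<open>walk A x p y\<close>
proof (induction "length p" arbitrary: p thesis rule: less_induct)
  case less
  show ?case
  proof (cases "length p \<le> k")
    case True
    then show ?thesis using less.prems by blast
  next
    case False
    then obtain a p' where p: "p = a # p'"
      by (cases p) auto
    have "a \<in> A" "fst a = x"
      using less.prems p by auto
    then have "x \<in> X"
      using X(2) by fastforce
    moreover have "snd (snd b) \<in> X" if "b \<in> set p" for b
      using X(2) walk_arcs[OF less.prems(2)] that by fastforce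
    ultimately have "set (x # map (snd \<circ> snd) p) \<subseteq> X"
      by auto
    then have "card (set (x # map (snd \<circ> snd) p)) \<le> Suc k"
      using \<open>finite X\<close> \<open>card X \<le> Suc k\<close> card_mono le_trans by blast
    then have "\<not> distinct (x # map (snd \<circ> snd) p)"
      using False distinct_card by fastforce
    then obtain p1 p2 p3 z where *: "p = p1 @ p2 @ p3" "p2 \<noteq> []"
      "walk A x p1 z" "walk A z p2 z" "walk A z p3 y"
      using walk_split_repeated_node less.prems(2) by metis
    moreover have "gain p2 \<le> 0"
      using npc *(4) by (auto simp: no_gainful_cycle_def)
    moreover obtain q where "walk A x q y" "gain (p1 @ p3) \<le> gain q" "length q \<le> k"
    proof (rule less.hyps[of "p1 @ p3"])
      show "length (p1 @ p3) < length p" using * by simp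
      show "walk A x (p1 @ p3) y" using * by (auto simp: walk_append)
    qed
    ultimately show ?thesis
      using less.prems(1)[of q] by auto
  qed
qed

text \<open>In a shortest closed walk of positive gain, a repeated node would give two shorter
  closed walks, one of which gains. Only heads of arcs are compared, because the start of a closed
  walk is itself the head of the last arc.\<close>

lemma simple_gainful_cycle:
  assumes "\<not> no_gainful_cycle A"
  obtains x p where "walk A x p x" "0 < gain p" "distinct (map (snd \<circ> snd) p)"
proof -
  define P where "P p \<longleftrightarrow> (\<exists>x. walk A x p x \<and> 0 < gain p)" for p
  obtain p0 where "P p0"
    using assms by (auto simp: no_gainful_cycle_def P_def not_le)
  then obtain p where "P p" and least: "\<And>q. P q \<Longrightarrow> length p \<le> length q"
    using ex_has_least_nat[of P p0 length] by blast
  then obtain x where p: "walk A x p x" "0 < gain p"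
    by (auto simp: P_def)
  then obtain a p' where a: "p = a # p'"
    by (cases p) auto
  have "distinct (snd (snd a) # map (snd \<circ> snd) p')"
  proof (rule ccontr)
    assume "\<not> ?thesis"
    moreover have "walk A (snd (snd a)) p' x" using p a by simp
    ultimately obtain p1 p2 p3 z where *: "p' = p1 @ p2 @ p3" "p2 \<noteq> []"
      "walk A (snd (snd a)) p1 z" "walk A z p2 z" "walk A z p3 x"
      using walk_split_repeated_node by metis
    have "walk A x (a # p1 @ p3) x"
      using * p a by (auto simp: walk_append)
    then have "gain p2 \<le> 0" "gain (a # p1 @ p3) \<le> 0"
      using least[of p2] least[of "a # p1 @ p3"] * a unfolding P_def by (force simp: not_less)+
    then show False using p(2) a * by simp
  qed
  then show ?thesis using that[OF p] a by simp
qed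

text \<open>Lets a closed walk through \<open>Root\<close> start there; the heads are only permuted,
  so simplicity survives.\<close>

lemma rotate_cycle:
  assumes "walk A x p x" "y \<in> (snd \<circ> snd) ` set p"
  obtains q where "walk A y q y" "gain q = gain p"
    "distinct (map (snd \<circ> snd) q) \<longleftrightarrow> distinct (map (snd \<circ> snd) p)"
proof -
  obtain b where b: "b \<in> set p" "snd (snd b) = y"
    using assms(2) unfolding image_iff comp_def by metis
  then obtain r s where p: "p = r @ b # s"
    by (meson split_list)
  show ?thesis
  proof
    show "walk A y (s @ r @ [b]) y"
      using assms(1) b p by (auto simp: walk_append)
  qed (auto simp: p)
qed

section \<open>Bellman-Ford relaxation for longest walks\<close>

fun relax :: "'n arc \<Rightarrow> ('n \<Rightarrow> real) \<times> bool \<Rightarrow> ('n \<Rightarrow> real) \<times> bool" where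
  "relax (x, g, y) (d, b) = (if d y < d x + g then (d(y := d x + g), True) else (d, b))"

text \<open>The flag is cleared first so that it speaks about this sweep alone: it tells whether the
  labels before the sweep violated some arc inequality.\<close>

definition pass :: "'n arc list \<Rightarrow> ('n \<Rightarrow> real) \<times> bool \<Rightarrow> ('n \<Rightarrow> real) \<times> bool" where
  "pass L s = fold relax L (fst s, False)"

lemma relax_ge: "fst s x \<le> fst (relax a s) x"
  by (cases a; cases s) auto

lemma fold_relax_ge: "fst s x \<le> fst (fold relax L s) x"
proof (induction L arbitrary: s)
  case (Cons a L)
  then show ?case using relax_ge[of s x a] by (metis fold_simps(2) order_trans)
qed simp

text \<open>Labels are updated in place, so the tail may have changed before its arc is reached.
  Since labels only grow, the old label of \<open>x\<close> and the final label of \<open>y\<close>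
  still satisfy the inequality.\<close>

lemma fold_relax_arc:
  "(x, g, y) \<in> set L \<Longrightarrow> fst s x + g \<le> fst (fold relax L s) y"
proof (induction L arbitrary: s)
  case (Cons a L)
  show ?case
  proof (cases "a = (x, g, y)")
    case True
    have "fst s x + g \<le> fst (relax a s) y"
      using True by (cases s) auto
    then show ?thesis
      using fold_relax_ge[of "relax a s" y L] by simp
  next
    case False
    then have "fst (relax a s) x + g \<le> fst (fold relax L (relax a s)) y"
      using Cons by auto
    then show ?thesis
      using relax_ge[of s x a] by simp
  qed
qed simp

lemma fold_relax_flag: "snd s \<Longrightarrow> snd (fold relax L s)"
proof (induction L arbitrary: s)
  case (Cons a L)
  have "snd (relax a s)"
    using Cons.prems by (cases a; cases s) auto
  then show ?case using Cons.IH by simp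
qed simp

text \<open>Until the first update the labels are still \<open>d\<close>, so an unflagged sweep has
  checked every arc against the same \<open>d\<close>.\<close>

lemma fold_relax_unflagged:
  "\<not> snd (fold relax L (d, False)) \<longleftrightarrow> potential (set L) d"
proof (induction L)
  case (Cons a L)
  obtain x g y where a: "a = (x, g, y)" by (cases a)
  show ?case
  proof (cases "d y < d x + g")
    case True
    then have "snd (fold relax (a # L) (d, False))"
      by (auto simp: a intro: fold_relax_flag)
    then show ?thesis using True by (auto simp: a potential_def)
  next
    case False
    then show ?thesis using Cons by (auto simp: a potential_def)
  qed
qed (simp add: potential_def)

lemma pass_realised:
  assumes "set L \<subseteq> A" "\<forall>y. \<exists>x p. walk A x p y \<and> fst s y = d0 x + gain p"
  shows "\<exists>x p. walk A x p y \<and> fst (fold relax L s) y = d0 x + gain p"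
  using assms
proof (induction L arbitrary: s y)
  case (Cons a L)
  obtain u g v where a: "a = (u, g, v)" by (cases a)
  have "\<exists>x p. walk A x p z \<and> fst (relax a s) z = d0 x + gain p" for z
  proof (cases "z = v \<and> fst s v < fst s u + g")
    case True
    obtain x p where xp: "walk A x p u" "fst s u = d0 x + gain p"
      using Cons.prems(2) by blast
    then have "walk A x (p @ [a]) v \<and> fst (relax a s) z = d0 x + gain (p @ [a])"
      using True Cons.prems(1) by (cases s) (auto simp: a walk_append)
    then show ?thesis using True by blast
  next
    case False
    then have "fst (relax a s) z = fst s z"
      by (cases s) (auto simp: a)
    then show ?thesis using Cons.prems(2) by simp
  qed
  then show ?case using Cons.IH[of "relax a s" y] Cons.prems(1) by simp
qed simp

text \<open>The length of \<open>p\<close> is not bounded: updates reuse labels changed in the same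
  sweep, so \<open>k\<close> sweeps may follow walks of more than \<open>k\<close> arcs. Together
  with \<open>passes_dominate\<close> this encloses the labels from both sides.\<close>

lemma passes_realised:
  "\<exists>x p. walk (set L) x p y \<and> fst ((pass L ^^ k) s) y = fst s x + gain p"
proof (induction k arbitrary: y)
  case 0
  have "walk (set L) y [] y \<and> fst ((pass L ^^ 0) s) y = fst s y + gain []" by simp
  then show ?case by blast
next
  case (Suc k)
  have "\<forall>y. \<exists>x p. walk (set L) x p y \<and> fst (fst ((pass L ^^ k) s), False) y = fst s x + gain p"
    using Suc.IH by simp
  from pass_realised[OF subset_refl this, of y] show ?case
    by (simp add: pass_def[of L "(pass L ^^ k) s"])
qed

lemma passes_dominate:
  "walk (set L) x p y \<Longrightarrow> length p \<le> k \<Longrightarrow> fst s x + gain p \<le> fst ((pass L ^^ k) s) y"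
proof (induction k arbitrary: p y)
  case (Suc k)
  let ?d = "(pass L ^^ k) s"
  have ge: "fst ?d z \<le> fst ((pass L ^^ Suc k) s) z" for z
    using fold_relax_ge[of "(fst ?d, False)" z L] by (simp add: pass_def)
  show ?case
  proof (cases p rule: rev_cases)
    case Nil
    then show ?thesis using Suc.IH[of "[]" y] Suc.prems ge[of y] by simp
  next
    case (snoc q a)
    then obtain z g where a: "a = (z, g, y)" "walk (set L) x q z" "a \<in> set L"
      using Suc.prems(1) by (cases a) (auto simp: walk_append)
    have "fst ?d z + g \<le> fst ((pass L ^^ Suc k) s) y"
      using fold_relax_arc[of z g y L "(fst ?d, False)"] a by (simp add: pass_def)
    moreover have "fst s x + gain q \<le> fst ?d z"
      using Suc.IH[of q z] a snoc Suc.prems(2) by simp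
    ultimately show ?thesis using snoc a by simp
  qed
qed simp

text \<open>The initial labels are arbitrary: a walk is compared with shorter walks having the same
  starting point, so that the label of that point cancels.\<close>

theorem passes_potential:
  assumes "no_gainful_cycle (set L)" "finite X" "\<forall>(x, g, y)\<in>set L. x \<in> X \<and> y \<in> X"
    and "card X \<le> Suc k"
  shows "potential (set L) (fst ((pass L ^^ k) s))"
  unfolding potential_def
proof (clarify)
  fix x g y assume a: "(x, g, y) \<in> set L"
  obtain z p where p: "walk (set L) z p x" "fst ((pass L ^^ k) s) x = fst s z + gain p"
    using passes_realised by metis
  have "walk (set L) z (p @ [(x, g, y)]) y"
    using p a by (auto simp: walk_append)
  then obtain q where "walk (set L) z q y" "gain (p @ [(x, g, y)]) \<le> gain q" "length q \<le> k"
    using walk_shorten[OF assms] by metis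
  then show "fst ((pass L ^^ k) s) x + g \<le> fst ((pass L ^^ k) s) y"
    using passes_dominate[of L z q y k s] p by simp
qed

text \<open>If no closed walk gains, \<open>k\<close> sweeps reach a potential; sweep
  \<open>Suc k\<close> only checks the result.\<close>

corollary passes_flag_iff:
  assumes "finite X" "\<forall>(x, g, y)\<in>set L. x \<in> X \<and> y \<in> X" "card X \<le> Suc k"
  shows "\<not> snd ((pass L ^^ Suc k) s) \<longleftrightarrow> no_gainful_cycle (set L)"
proof -
  have "(\<not> snd ((pass L ^^ Suc k) s)) = potential (set L) (fst ((pass L ^^ k) s))"
    using fold_relax_unflagged by (simp add: pass_def)
  then show ?thesis
    using passes_potential[OF _ assms] potential_no_gainful_cycle by blast
qed

text \<open>The algorithm doubles as an existence proof: run on any enumeration of the arcs, it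
  yields the potential that duality needs.\<close>

corollary no_gainful_cycle_potential:
  assumes "no_gainful_cycle A" "finite A"
  obtains f where "potential A f"
proof -
  obtain L where L: "set L = A"
    using \<open>finite A\<close> finite_list by blast
  let ?X = "fst ` A \<union> (snd \<circ> snd) ` A"
  have "finite ?X" "\<forall>(x, g, y)\<in>set L. x \<in> ?X \<and> y \<in> ?X"
    using assms(2) L by force+
  then show ?thesis
    using passes_potential[of L ?X "card ?X"] assms(1) L that by (metis lessI less_imp_le)
qed

section \<open>The residual digraph of a matching\<close>

datatype 'a node = Root | Pos 'a | Neg 'a

definition mdeg :: "'a set set \<Rightarrow> 'a \<Rightarrow> nat" where
  "mdeg M v = card {e \<in> M. v \<in> e}"

text \<open>Residual network of the symmetric lift of \<open>M\<close> to the bipartite double cover, whose vertices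
  are \<open>Pos v\<close> and \<open>Neg v\<close>; source and sink of the usual network are identified to \<open>Root\<close>.\<close>

inductive_set residual ::
  "'a set set \<Rightarrow> ('a set \<Rightarrow> real) \<Rightarrow> ('a \<Rightarrow> nat) \<Rightarrow> 'a set set \<Rightarrow> 'a set \<Rightarrow> 'a node arc set"
  for E w c M U where
  add: "{a, b} \<in> E - M \<Longrightarrow> a \<in> U \<Longrightarrow> b \<in> U \<Longrightarrow> (Pos a, w {a, b}, Neg b) \<in> residual E w c M U"
| del: "{a, b} \<in> M \<Longrightarrow> a \<in> U \<Longrightarrow> b \<in> U \<Longrightarrow> (Neg a, - w {a, b}, Pos b) \<in> residual E w c M U"
| Root_Pos: "v \<in> U \<Longrightarrow> mdeg M v < c v \<Longrightarrow> (Root, 0, Pos v) \<in> residual E w c M U"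
| Neg_Root: "v \<in> U \<Longrightarrow> mdeg M v < c v \<Longrightarrow> (Neg v, 0, Root) \<in> residual E w c M U"
| Pos_Root: "v \<in> U \<Longrightarrow> 0 < mdeg M v \<Longrightarrow> (Pos v, 0, Root) \<in> residual E w c M U"
| Root_Neg: "v \<in> U \<Longrightarrow> 0 < mdeg M v \<Longrightarrow> (Root, 0, Neg v) \<in> residual E w c M U"

lemma residual_arc_cases [consumes 1, case_names add del Root_Pos Neg_Root Pos_Root Root_Neg]:
  assumes "r \<in> residual E w c M U"
  obtains a b where "r = (Pos a, w {a, b}, Neg b)" "{a, b} \<in> E" "{a, b} \<notin> M" "a \<in> U" "b \<in> U"
  | a b where "r = (Neg a, - w {a, b}, Pos b)" "{a, b} \<in> M" "a \<in> U" "b \<in> U"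
  | v where "r = (Root, 0, Pos v)" "v \<in> U" "mdeg M v < c v"
  | v where "r = (Neg v, 0, Root)" "v \<in> U" "mdeg M v < c v"
  | v where "r = (Pos v, 0, Root)" "v \<in> U" "0 < mdeg M v"
  | v where "r = (Root, 0, Neg v)" "v \<in> U" "0 < mdeg M v"
proof (cases r)
  case (fields x g y)
  with assms have "(x, g, y) \<in> residual E w c M U" by simp
  then show ?thesis
    using that unfolding fields by cases (simp_all only: Diff_iff not_False_eq_True)
qed

text \<open>Symmetry of the double cover: exchanging the copies \<open>Pos v\<close> and
  \<open>Neg v\<close> reverses all arcs, because source and sink change places.\<close>

fun mirror :: "'a node \<Rightarrow> 'a node" where
  "mirror Root = Root" | "mirror (Pos v) = Neg v" | "mirror (Neg v) = Pos v"

definition mirror_arc :: "'a node arc \<Rightarrow> 'a node arc" where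
  "mirror_arc a = (mirror (snd (snd a)), fst (snd a), mirror (fst a))"

definition arc_verts :: "'a node arc \<Rightarrow> 'a set" where
  "arc_verts a = set_node (fst a) \<union> set_node (snd (snd a))"

text \<open>Pushing one unit along the arc \<open>a\<close> changes the value of the edge \<open>e\<close> by \<open>push a e\<close>.\<close>

fun push :: "'a node arc \<Rightarrow> 'a set \<Rightarrow> real" where
  "push (Pos a, g, Neg b) e = of_bool (e = {a, b})"
| "push (Neg a, g, Pos b) e = - of_bool (e = {a, b})"
| "push _ e = 0"

definition pushes :: "'a node arc list \<Rightarrow> 'a set \<Rightarrow> real" where
  "pushes p e = (\<Sum>a\<leftarrow>p. push a e)"

text \<open>Counts the two arcs that use up spare capacity of \<open>v\<close>. The opposite arcs
  lower the degree and are left out, hence the inequality in \<open>sum_pushes_le\<close>.\<close>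

definition raise_arcs :: "'a node arc list \<Rightarrow> 'a \<Rightarrow> nat" where
  "raise_arcs p v = count_list p (Root, 0, Pos v) + count_list p (Neg v, 0, Root)"

lemma mirror_mirror [simp]: "mirror (mirror x) = x"
  by (cases x) auto

lemma set_node_mirror [simp]: "set_node (mirror x) = set_node x"
  by (cases x) auto

lemma mirror_arc_simps [simp]:
  "mirror_arc (mirror_arc a) = a"
  "fst (mirror_arc a) = mirror (snd (snd a))"
  "fst (snd (mirror_arc a)) = fst (snd a)"
  "snd (snd (mirror_arc a)) = mirror (fst a)"
  "arc_verts (mirror_arc a) = arc_verts a"
  by (auto simp: mirror_arc_def arc_verts_def)

lemma mirror_arc_residual:
  assumes "r \<in> residual E w c M U"
  shows "mirror_arc r \<in> residual E w c M U"
  using assms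
proof (cases rule: residual_arc_cases)
  case (add a b)
  then show ?thesis
    using residual.add[of b a E M U w c] by (simp add: mirror_arc_def insert_commute)
next
  case (del a b)
  then show ?thesis
    using residual.del[of b a M U w E c] by (simp add: mirror_arc_def insert_commute)
qed (auto simp: mirror_arc_def intro: residual.intros)

lemma gain_mirror: "gain (rev (map mirror_arc p)) = gain p"
  by (induction p) auto

lemma walk_mirror:
  assumes "walk (residual E w c M U) x p y"
  shows "walk (residual E w c M U) (mirror y) (rev (map mirror_arc p)) (mirror x)"
  using assms by (induction p arbitrary: x) (auto simp: walk_append mirror_arc_residual)

lemma residual_restrict:
  "a \<in> residual E w c M U \<Longrightarrow> arc_verts a \<subseteq> U' \<Longrightarrow> a \<in> residual E w c M U'"
  by (cases rule: residual_arc_cases) (auto simp: arc_verts_def intro: residual.intros)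

lemma residual_verts: "a \<in> residual E w c M U \<Longrightarrow> arc_verts a \<subseteq> U"
  by (cases rule: residual_arc_cases) (auto simp: arc_verts_def)

lemma residual_mono: "U \<subseteq> U' \<Longrightarrow> residual E w c M U \<subseteq> residual E w c M U'"
  by (meson residual_restrict residual_verts subset_iff subset_trans)

section \<open>Effect of closed walks on degrees, weight and edge values\<close>

lemma walk_balance:
  assumes "walk A x p y"
  shows "(\<Sum>a\<leftarrow>p. of_bool (fst a = z) - of_bool (snd (snd a) = z)) =
    (of_bool (x = z) - of_bool (y = z) :: real)"
  using assms by (induction p arbitrary: x) auto

text \<open>Along a closed walk the arcs at \<open>Root\<close> compensate the other ones, so they
  count the change of the degree of \<open>v\<close>.\<close>

lemma sum_pushes_le:
  assumes "walk A x p x" "A \<subseteq> residual E w c M U" "M \<subseteq> E" "finite F"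
    "\<And>e. e \<in> E \<Longrightarrow> e \<subseteq> U \<Longrightarrow> card e = 2 \<and> e \<in> F"
  shows "(\<Sum>e | e \<in> F \<and> v \<in> e. pushes p e) \<le> real (raise_arcs p v)"
proof -
  define bal :: "'a node \<Rightarrow> 'a node arc \<Rightarrow> real" where
    "bal z a = of_bool (fst a = z) - of_bool (snd (snd a) = z)" for z a
  have ind: "(\<Sum>e | e \<in> F \<and> v \<in> e. of_bool (e = {a, b}) :: real) = of_bool (a = v) + of_bool (b = v)"
    if "{a, b} \<in> F" "a \<noteq> b" for a b
    using that \<open>finite F\<close> by (auto simp: of_bool_def)
  \<comment> \<open>Equality holds for edge arcs and for the arcs counted on the right. The slack
    comes from the arcs \<open>Pos v\<close> to \<open>Root\<close> and \<open>Root\<close> to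
    \<open>Neg v\<close>, which lower the degree of \<open>v\<close>. Over a closed walk the
    balances cancel.\<close>
  have arc: "(\<Sum>e | e \<in> F \<and> v \<in> e. push a e) \<le> bal (Pos v) a - bal (Neg v) a +
      of_bool (a = (Root, 0, Pos v)) + of_bool (a = (Neg v, 0, Root))"
    if "a \<in> residual E w c M U" for a
    using that
  proof (cases rule: residual_arc_cases)
    case (add a' b')
    then have "card {a', b'} = 2" "{a', b'} \<in> F" using assms(5) by auto
    then have "a' \<noteq> b'" by auto
    then show ?thesis using add ind[OF \<open>{a', b'} \<in> F\<close>] by (simp add: bal_def)
  next
    case (del a' b')
    then have "card {a', b'} = 2" "{a', b'} \<in> F" using assms(3,5) by auto
    then have "a' \<noteq> b'" by auto
    then show ?thesis using del ind[OF \<open>{a', b'} \<in> F\<close>]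
      by (simp add: bal_def sum_negf)
  qed (auto simp: bal_def)
  have *: "(\<Sum>e | e \<in> F \<and> v \<in> e. pushes p e) \<le>
      (\<Sum>a\<leftarrow>p. bal (Pos v) a) - (\<Sum>a\<leftarrow>p. bal (Neg v) a) + real (raise_arcs p v)"
    if "set p \<subseteq> residual E w c M U" for p
    using that
  proof (induction p)
    case (Cons a p)
    then have "(\<Sum>e | e \<in> F \<and> v \<in> e. pushes p e) \<le>
      (\<Sum>a\<leftarrow>p. bal (Pos v) a) - (\<Sum>a\<leftarrow>p. bal (Neg v) a) + real (raise_arcs p v)"
      by auto
    moreover have "(\<Sum>e | e \<in> F \<and> v \<in> e. pushes (a # p) e) =
      (\<Sum>e | e \<in> F \<and> v \<in> e. push a e) + (\<Sum>e | e \<in> F \<and> v \<in> e. pushes p e)"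
      by (simp add: pushes_def sum.distrib)
    moreover have "real (raise_arcs (a # p) v) = real (raise_arcs p v) +
      of_bool (a = (Root, 0, Pos v)) + of_bool (a = (Neg v, 0, Root))"
      by (auto simp: raise_arcs_def)
    ultimately show ?case
      using arc[of a] Cons.prems by auto
  qed (simp add: pushes_def raise_arcs_def)
  have "(\<Sum>a\<leftarrow>p. bal z a) = 0" for z
    unfolding bal_def using walk_balance[OF assms(1), of z] by simp
  then show ?thesis
    using *[OF subset_trans[OF walk_arcs[OF assms(1)] assms(2)]] by simp
qed

lemma gain_eq_sum_pushes:
  assumes "set p \<subseteq> residual E w c M U" "M \<subseteq> E" "finite F"
    "\<And>e. e \<in> E \<Longrightarrow> e \<subseteq> U \<Longrightarrow> e \<in> F"
  shows "(\<Sum>e\<in>F. w e * pushes p e) = gain p"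
  using assms(1)
proof (induction p)
  case (Cons a p)
  have "(\<Sum>e\<in>F. w e * push a e) = fst (snd a)"
    using Cons.prems[simplified, THEN conjunct1]
  proof (cases rule: residual_arc_cases)
    case (add a' b')
    then have "{a', b'} \<in> F" using assms(4) by auto
    then show ?thesis using add \<open>finite F\<close>
      by (simp add: of_bool_def if_distrib[of "\<lambda>x. _ * x"] cong: if_cong)
  next
    case (del a' b')
    then have "{a', b'} \<in> F" using assms(2,4) by auto
    then show ?thesis using del \<open>finite F\<close>
      by (simp add: of_bool_def sum_negf if_distrib[of "\<lambda>x. _ * x"] cong: if_cong)
  qed auto
  then show ?case
    using Cons by (simp add: pushes_def sum.distrib algebra_simps)
qed (simp add: pushes_def)

lemma push_sign:
  assumes "a \<in> residual E w c M U"
  shows "if e \<in> M then - 1 \<le> push a e \<and> push a e \<le> 0 else 0 \<le> push a e \<and> push a e \<le> 1"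
  using assms by (cases rule: residual_arc_cases) auto

text \<open>Edges of \<open>M\<close> are only lowered and all others only raised, so only one of
  the two bounds on an edge value is ever at risk, and only from pushing too much.\<close>

lemma pushes_bounds:
  assumes "set p \<subseteq> residual E w c M U"
  shows "if e \<in> M then - real (length p) \<le> pushes p e \<and> pushes p e \<le> 0
    else 0 \<le> pushes p e \<and> pushes p e \<le> real (length p)"
  using assms
proof (induction p)
  case (Cons a p)
  then show ?case using push_sign[of a E w c M U e] by (auto simp: pushes_def split: if_splits)
qed (simp add: pushes_def)

lemma push_nonzero:
  assumes "a \<in> residual E w c M U" "push a e \<noteq> 0"
  obtains x y where "e = {x, y}" "e \<notin> M" "a = (Pos x, w e, Neg y)"
  | x y where "e = {x, y}" "e \<in> M" "a = (Neg x, - w e, Pos y)"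
  using assms(1)
proof (cases rule: residual_arc_cases)
  case (add x y)
  with assms(2) have "e = {x, y}" by simp
  with add that(1) show ?thesis by blast
next
  case (del x y)
  with assms(2) have "e = {x, y}" by simp
  with del that(2) show ?thesis by blast
qed (use assms in auto)

text \<open>Membership in \<open>M\<close> fixes the direction in which an edge is lifted, and its
  two lifts are mirror images of each other.\<close>

lemma push_same_edge:
  assumes "a \<in> residual E w c M U" "a' \<in> residual E w c M U" "push a e \<noteq> 0" "push a' e \<noteq> 0"
  shows "a' = a \<or> a' = mirror_arc a"
  by (rule push_nonzero[OF assms(1,3)]; rule push_nonzero[OF assms(2,4)])
     (auto simp: mirror_arc_def doubleton_eq_iff)

text \<open>At most one arc of \<open>p\<close> then acts on \<open>e\<close>. The assumption is
  about \<open>push a e\<close> rather than the absence of mirror arcs, which exempts the arcs at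
  \<open>Root\<close>.\<close>

lemma pushes_no_repeated_edge:
  assumes "set p \<subseteq> residual E w c M U" "distinct p"
    and "\<And>a. a \<in> set p \<Longrightarrow> mirror_arc a \<in> set p \<Longrightarrow> push a e = 0"
  shows "pushes p e \<in> {-1, 0, 1}"
proof -
  have eq: "pushes p e = (\<Sum>a\<in>set p. push a e)"
    using \<open>distinct p\<close> by (simp add: pushes_def sum_list_distinct_conv_sum_set)
  show ?thesis
  proof (cases "\<exists>a\<in>set p. push a e \<noteq> 0")
    case True
    then obtain a where a: "a \<in> set p" "push a e \<noteq> 0" by blast
    have "push a' e = 0" if "a' \<in> set p" "a' \<noteq> a" for a'
      using push_same_edge[of a E w c M U a' e] a that assms(1,3) by (metis subsetD)
    then have "pushes p e = push a e"
      unfolding eq using a(1) by (subst sum.remove[of _ a]) auto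
    moreover have "push a e \<in> {-1, 0, 1}"
      by (cases "(a, e)" rule: push.cases) auto
    ultimately show ?thesis by simp
  qed (simp add: eq)
qed

section \<open>Stability and minimum stabilizers\<close>

lemma sum_edges_vertices:
  fixes y :: "'a \<Rightarrow> real"
  assumes "finite U" "finite F" "\<And>e. e \<in> F \<Longrightarrow> e \<subseteq> U"
  shows "(\<Sum>e\<in>F. (\<Sum>v\<in>e. y v) * x e) = (\<Sum>v\<in>U. y v * (\<Sum>e | e \<in> F \<and> v \<in> e. x e))"
proof -
  have "(\<Sum>e\<in>F. (\<Sum>v\<in>e. y v) * x e) = (\<Sum>e\<in>F. \<Sum>v | v \<in> U \<and> v \<in> e. y v * x e)"
    using assms(3) by (intro sum.cong) (auto simp: sum_distrib_right intro!: sum.cong)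
  also have "\<dots> = (\<Sum>v\<in>U. \<Sum>e | e \<in> F \<and> v \<in> e. y v * x e)"
    using sum.swap_restrict[OF assms(2,1), of "\<lambda>e v. y v * x e" "\<lambda>e v. v \<in> e"] by simp
  finally show ?thesis by (simp add: sum_distrib_left)
qed

locale matched_graph =
  fixes V :: "'a set" and E :: "'a set set" and w :: "'a set \<Rightarrow> real" and c :: "'a \<Rightarrow> nat"
    and M :: "'a set set"
  assumes graph: "simple_graph V E" and M_max: "max_weight_c_matching V E w c M"
begin

abbreviation R :: "'a set \<Rightarrow> 'a node arc set" where
  "R U \<equiv> residual E w c M U"

definition covered :: "'a set" where
  "covered = {v \<in> V. 0 < mdeg M v}"

lemma finite_V: "finite V" and edge: "e \<in> E \<Longrightarrow> e \<subseteq> V \<and> card e = 2" and finite_E: "finite E"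
  using graph finite_subset[of E "Pow V"] by (auto simp: simple_graph_def)

lemma M_sub: "M \<subseteq> E" and mdeg_le: "v \<in> V \<Longrightarrow> mdeg M v \<le> c v" and finite_M: "finite M"
  using M_max finite_E finite_subset[of M E]
  by (auto simp: max_weight_c_matching_def c_matching_def mdeg_def)

lemma matched_covered: "e \<in> M \<Longrightarrow> e \<subseteq> covered"
  using edge M_sub finite_M by (force simp: covered_def mdeg_def card_gt_0_iff)

lemma covered_sub: "covered \<subseteq> V"
  by (auto simp: covered_def)

lemma M_induced: "covered \<subseteq> U \<Longrightarrow> M \<subseteq> induced_edges E U"
  using matched_covered M_sub by (fastforce simp: induced_edges_def)

lemma c_matching_weight_le:
  assumes "c_matching V E c N"
  shows "sum w N \<le> sum w M"
proof -
  have "{sum w N | N. c_matching V E c N} \<subseteq> sum w ` Pow E"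
    by (auto simp: c_matching_def)
  then have "finite {sum w N | N. c_matching V E c N}"
    using finite_E finite_subset by blast
  then have "sum w N \<le> nu V E w c"
    unfolding nu_def using assms by (intro Max_ge) auto
  then show ?thesis using M_max by (simp add: max_weight_c_matching_def)
qed

lemma induced_c_matching:
  assumes "c_matching U (induced_edges E U) c N"
  shows "c_matching V E c N"
  unfolding c_matching_def
proof (intro conjI ballI)
  show "N \<subseteq> E" using assms by (auto simp: c_matching_def induced_edges_def)
  fix v assume "v \<in> V"
  show "card {e \<in> N. v \<in> e} \<le> c v"
  proof (cases "v \<in> U")
    case False
    then have "{e \<in> N. v \<in> e} = {}"
      using assms by (auto simp: c_matching_def induced_edges_def)
    then show ?thesis by (simp only: card.empty)
  qed (use assms in \<open>auto simp: c_matching_def\<close>)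
qed

lemma c_matching_M:
  assumes "covered \<subseteq> U" "U \<subseteq> V"
  shows "c_matching U (induced_edges E U) c M"
  using M_induced[OF assms(1)] assms(2) mdeg_le by (auto simp: c_matching_def mdeg_def)

lemma nu_induced:
  assumes "covered \<subseteq> U" "U \<subseteq> V"
  shows "nu U (induced_edges E U) w c = sum w M"
  unfolding nu_def
proof (rule Max_eqI)
  have "{sum w N | N. c_matching U (induced_edges E U) c N} \<subseteq> sum w ` Pow E"
    by (auto simp: c_matching_def induced_edges_def)
  then show "finite {sum w N | N. c_matching U (induced_edges E U) c N}"
    using finite_E finite_subset by blast
qed (use c_matching_M[OF assms] c_matching_weight_le induced_c_matching in auto)

lemma simple_graph_induced: "U \<subseteq> V \<Longrightarrow> simple_graph U (induced_edges E U)"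
  using edge finite_V finite_subset by (auto simp: simple_graph_def induced_edges_def)

lemma finite_induced: "finite (induced_edges E U)"
  using finite_E by (simp add: induced_edges_def)

lemma sum_indicator_M:
  assumes "covered \<subseteq> U"
  shows "(\<Sum>e\<in>induced_edges E U. w e * of_bool (e \<in> M)) = sum w M"
    "(\<Sum>e | e \<in> induced_edges E U \<and> v \<in> e. of_bool (e \<in> M) :: real) = mdeg M v"
proof -
  have "(\<Sum>e\<in>induced_edges E U. w e * of_bool (e \<in> M)) = (\<Sum>e\<in>M. w e * of_bool (e \<in> M))"
    using M_induced[OF assms] finite_induced by (intro sum.mono_neutral_right) auto
  then show "(\<Sum>e\<in>induced_edges E U. w e * of_bool (e \<in> M)) = sum w M"
    by simp
  have "(\<Sum>e | e \<in> induced_edges E U \<and> v \<in> e. of_bool (e \<in> M) :: real) =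
    (\<Sum>e | e \<in> M \<and> v \<in> e. of_bool (e \<in> M))"
    using M_induced[OF assms] finite_induced by (intro sum.mono_neutral_right) auto
  then show "(\<Sum>e | e \<in> induced_edges E U \<and> v \<in> e. of_bool (e \<in> M) :: real) = mdeg M v"
    by (simp add: mdeg_def)
qed

section \<open>Stability through linear programming duality\<close>

lemma stable_iff_M_optimal:
  assumes "covered \<subseteq> U" "U \<subseteq> V"
  shows "stable U (induced_edges E U) w c \<longleftrightarrow>
    (\<forall>x. fractional_c_matching U (induced_edges E U) c x \<longrightarrow>
      (\<Sum>e\<in>induced_edges E U. w e * x e) \<le> sum w M)"
proof -
  let ?F = "induced_edges E U"
  obtain x where x: "fractional_c_matching U ?F c x" "nu_f U ?F w c = (\<Sum>e\<in>?F. w e * x e)"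
    "\<And>y. fractional_c_matching U ?F c y \<Longrightarrow> (\<Sum>e\<in>?F. w e * y e) \<le> (\<Sum>e\<in>?F. w e * x e)"
    using nu_f_attained[OF simple_graph_induced[OF assms(2)]] by metis
  have "fractional_c_matching U ?F c (\<lambda>e. of_bool (e \<in> M))"
    using mdeg_le assms by (auto simp: fractional_c_matching_def sum_indicator_M(2)[OF assms(1)])
  then have "sum w M \<le> (\<Sum>e\<in>?F. w e * x e)"
    using x(3) sum_indicator_M(1)[OF assms(1)] by fastforce
  then show ?thesis
    using x nu_induced[OF assms] by (fastforce simp: stable_def)
qed

text \<open>Halving the potential differences \<open>f (Neg v) - f (Pos v)\<close> gives an optimal dual solution.\<close>

lemma potential_M_optimal:
  assumes U: "covered \<subseteq> U" "U \<subseteq> V" and f: "potential (R U) f"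
    and x: "fractional_c_matching U (induced_edges E U) c x"
  shows "(\<Sum>e\<in>induced_edges E U. w e * x e) \<le> sum w M"
proof -
  let ?F = "induced_edges E U"
  define h where "h v = (f (Neg v) - f (Pos v)) / 2" for v
  \<comment> \<open>Nothing bounds \<open>h v\<close> from below at an exposed vertex, hence the
    truncation at 0. It can only help to cover edges outside \<open>M\<close>, and tightness on
    \<open>M\<close> survives, since edges of \<open>M\<close> have covered endpoints.\<close>
  define y where "y v = (if mdeg M v = 0 then max (h v) 0 else h v)" for v
  define z where "z e = (\<Sum>v\<in>e. y v)" for e
  have pot: "f u + g \<le> f v" if "(u, g, v) \<in> R U" for u g v
    using f that by (auto simp: potential_def)
  have nonneg: "0 \<le> y v" if "v \<in> U" for v
  proof (cases "mdeg M v = 0")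
    case False
    then have "f (Pos v) \<le> f Root" "f Root \<le> f (Neg v)"
      using pot[OF residual.Pos_Root] pot[OF residual.Root_Neg] that by fastforce+
    then show ?thesis using False by (simp add: y_def h_def)
  qed (simp add: y_def)
  \<comment> \<open>Complementary slackness: spare capacity forces \<open>h v \<le> 0\<close> and
    hence \<open>y v = 0\<close>; otherwise capacity and degree agree.\<close>
  have slack: "y v * c v = y v * mdeg M v" if "v \<in> U" for v
  proof (cases "mdeg M v < c v")
    case True
    then have "f Root \<le> f (Pos v)" "f (Neg v) \<le> f Root"
      using pot[OF residual.Root_Pos] pot[OF residual.Neg_Root] that by fastforce+
    then have "h v \<le> 0" by (simp add: h_def)
    then have "y v = 0" using nonneg[OF that] by (auto simp: y_def split: if_splits)
    then show ?thesis by simp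
  next
    case False
    then show ?thesis using mdeg_le that U(2) by (metis le_neq_implies_less subsetD)
  qed
  have pair: "\<exists>a b. e = {a, b} \<and> a \<noteq> b \<and> a \<in> U \<and> b \<in> U" if "e \<in> ?F" for e
    using that edge[of e] by (auto simp: induced_edges_def card_2_iff)
  have cover: "w e \<le> z e" if "e \<in> ?F" "e \<notin> M" for e
  proof -
    obtain a b where e: "e = {a, b}" "a \<noteq> b" "a \<in> U" "b \<in> U" using pair \<open>e \<in> ?F\<close> by blast
    have E: "{a, b} \<in> E - M" "{b, a} \<in> E - M"
      using that e by (auto simp: induced_edges_def insert_commute)
    \<comment> \<open>The inequalities of the two lifts of \<open>e\<close>; their average is the
      constraint on \<open>h\<close>.\<close>
    have "f (Pos a) + w e \<le> f (Neg b)" "f (Pos b) + w e \<le> f (Neg a)"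
      using pot[OF residual.add[OF E(1) e(3,4)]] pot[OF residual.add[OF E(2) e(4,3)]] e(1)
      by (auto simp: insert_commute)
    then have "w e \<le> h a + h b" by (simp add: h_def field_simps)
    also have "\<dots> \<le> y a + y b" by (auto simp: y_def)
    finally show ?thesis using e by (simp add: z_def)
  qed
  have tight: "z e \<le> w e" if "e \<in> M" for e
  proof -
    have "e \<in> ?F" using M_induced[OF U(1)] that by blast
    then obtain a b where e: "e = {a, b}" "a \<noteq> b" "a \<in> U" "b \<in> U" using pair by blast
    have E: "{a, b} \<in> M" "{b, a} \<in> M" using that e by (auto simp: insert_commute)
    have "f (Neg a) - w e \<le> f (Pos b)" "f (Neg b) - w e \<le> f (Pos a)"
      using pot[OF residual.del[OF E(1) e(3,4)]] pot[OF residual.del[OF E(2) e(4,3)]] e(1)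
      by (auto simp: insert_commute)
    then have "h a + h b \<le> w e" by (simp add: h_def field_simps)
    moreover have "y a = h a" "y b = h b"
      using matched_covered[OF that] e by (auto simp: y_def covered_def)
    ultimately show ?thesis using e by (simp add: z_def)
  qed
  have finU: "finite U" using U finite_V finite_subset by blast
  have subU: "e \<subseteq> U" if "e \<in> ?F" for e using that by (simp add: induced_edges_def)
  \<comment> \<open>On \<open>M\<close> the difference \<open>w e - z e\<close> is the dual variable
    of the bound \<open>x e \<le> 1\<close>; outside \<open>M\<close> that variable is 0.\<close>
  have "w e * x e \<le> z e * x e + (w e - z e) * of_bool (e \<in> M)" if "e \<in> ?F" for e
  proof -
    have "0 \<le> x e" "x e \<le> 1" using x that by (auto simp: fractional_c_matching_def)
    then show ?thesis
      using cover[OF that] tight[of e] mult_left_mono[of "x e" 1 "w e - z e"]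
        mult_right_mono[of "w e" "z e" "x e"]
      by (cases "e \<in> M") (auto simp: algebra_simps)
  qed
  then have "(\<Sum>e\<in>?F. w e * x e) \<le>
      (\<Sum>e\<in>?F. z e * x e) + (\<Sum>e\<in>?F. (w e - z e) * of_bool (e \<in> M))"
    unfolding sum.distrib[symmetric] by (rule sum_mono)
  also have "(\<Sum>e\<in>?F. z e * x e) = (\<Sum>v\<in>U. y v * (\<Sum>e | e \<in> ?F \<and> v \<in> e. x e))"
    unfolding z_def by (rule sum_edges_vertices[OF finU finite_induced subU])
  also have "\<dots> \<le> (\<Sum>v\<in>U. y v * c v)"
    using x nonneg by (intro sum_mono mult_left_mono) (auto simp: fractional_c_matching_def)
  also have "\<dots> = (\<Sum>v\<in>U. y v * (\<Sum>e | e \<in> ?F \<and> v \<in> e. of_bool (e \<in> M)))"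
    unfolding sum_indicator_M(2)[OF U(1)] using slack by (rule sum.cong[OF refl])
  also have "\<dots> = (\<Sum>e\<in>?F. z e * of_bool (e \<in> M))"
    unfolding z_def by (rule sum_edges_vertices[OF finU finite_induced subU, symmetric])
  also have "\<dots> + (\<Sum>e\<in>?F. (w e - z e) * of_bool (e \<in> M)) = (\<Sum>e\<in>?F. w e * of_bool (e \<in> M))"
    unfolding sum.distrib[symmetric] by (simp add: algebra_simps)
  also have "\<dots> = sum w M" by (rule sum_indicator_M(1)[OF U(1)])
  finally show ?thesis by simp
qed

text \<open>Applied with a small \<open>\<epsilon>\<close> to refute fractional optimality and with
  \<open>\<epsilon> = 1\<close> to augment \<open>M\<close> integrally.\<close>

lemma shifted_matching:
  fixes \<epsilon> :: real
  assumes U: "covered \<subseteq> U" "U \<subseteq> V" and p: "walk (R U) u p u" and "0 \<le> \<epsilon>"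
    and small: "\<And>e. e \<in> induced_edges E U \<Longrightarrow> \<bar>\<epsilon> * pushes p e\<bar> \<le> 1"
    and deg: "\<And>v. v \<in> U \<Longrightarrow> mdeg M v + \<epsilon> * raise_arcs p v \<le> c v"
  defines "x \<equiv> \<lambda>e. of_bool (e \<in> M) + \<epsilon> * pushes p e"
  shows "fractional_c_matching U (induced_edges E U) c x"
    and "(\<Sum>e\<in>induced_edges E U. w e * x e) = sum w M + \<epsilon> * gain p"
proof -
  let ?F = "induced_edges E U"
  show "fractional_c_matching U ?F c x"
    unfolding fractional_c_matching_def
  proof (intro conjI ballI)
    fix v assume "v \<in> U"
    have "(\<Sum>e | e \<in> ?F \<and> v \<in> e. x e) = mdeg M v + \<epsilon> * (\<Sum>e | e \<in> ?F \<and> v \<in> e. pushes p e)"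
      by (simp add: x_def sum.distrib sum_distrib_left sum_indicator_M(2)[OF U(1)])
    also have "(\<Sum>e | e \<in> ?F \<and> v \<in> e. pushes p e) \<le> raise_arcs p v"
      using edge by (intro sum_pushes_le[OF p subset_refl M_sub finite_induced])
        (auto simp: induced_edges_def)
    finally have "(\<Sum>e | e \<in> ?F \<and> v \<in> e. x e) \<le> mdeg M v + \<epsilon> * raise_arcs p v"
      using \<open>0 \<le> \<epsilon>\<close> by (simp add: mult_left_mono)
    then show "(\<Sum>e | e \<in> ?F \<and> v \<in> e. x e) \<le> c v"
      using deg[OF \<open>v \<in> U\<close>] by simp
  next
    fix e assume e: "e \<in> ?F"
    have "if e \<in> M then \<epsilon> * pushes p e \<le> 0 else 0 \<le> \<epsilon> * pushes p e"
      using pushes_bounds[OF walk_arcs[OF p], of e] \<open>0 \<le> \<epsilon>\<close>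
      by (auto simp: mult_nonneg_nonpos split: if_splits)
    then show "0 \<le> x e" "x e \<le> 1"
      using small[OF e] by (auto simp: x_def split: if_splits)
  qed
  have "(\<Sum>e\<in>?F. w e * x e) = sum w M + \<epsilon> * (\<Sum>e\<in>?F. w e * pushes p e)"
    by (simp add: x_def distrib_left sum.distrib sum_distrib_left sum_indicator_M(1)[OF U(1)]
        mult.left_commute)
  also have "(\<Sum>e\<in>?F. w e * pushes p e) = gain p"
    by (intro gain_eq_sum_pushes[OF walk_arcs[OF p] M_sub finite_induced])
      (auto simp: induced_edges_def)
  finally show "(\<Sum>e\<in>?F. w e * x e) = sum w M + \<epsilon> * gain p" .
qed

lemma raise_arcs_pos:
  assumes "set p \<subseteq> R U" "0 < raise_arcs p v"
  shows "mdeg M v < c v"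
proof -
  have "(Root, 0, Pos v) \<in> R U \<or> (Neg v, 0, Root) \<in> R U"
    using assms count_notin[of "(Root, 0, Pos v)" p] count_notin[of "(Neg v, 0, Root)" p]
    by (force simp: raise_arcs_def)
  then show ?thesis by (auto elim: residual_arc_cases)
qed

lemma gainful_cycle_unstable:
  assumes U: "covered \<subseteq> U" "U \<subseteq> V" and p: "walk (R U) u p u" "0 < gain p"
  shows "\<not> stable U (induced_edges E U) w c"
proof -
  \<comment> \<open>An arc may be traversed up to \<open>length p\<close> times, and two arcs raise
    the degree of a vertex, whence the factor 2; the added 1 keeps the denominator positive.\<close>
  define \<epsilon> where "\<epsilon> = 1 / (2 * real (length p) + 1)"
  have eps: "0 < \<epsilon>" "\<epsilon> * length p \<le> 1" "\<epsilon> * (2 * length p) \<le> 1"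
    by (auto simp: \<epsilon>_def field_simps)
  have small: "\<bar>\<epsilon> * pushes p e\<bar> \<le> 1" for e
  proof -
    have "\<bar>pushes p e\<bar> \<le> length p"
      using pushes_bounds[OF walk_arcs[OF p(1)], of e] by (auto split: if_splits)
    then have "\<epsilon> * \<bar>pushes p e\<bar> \<le> \<epsilon> * length p"
      using eps by (intro mult_left_mono) auto
    then have "\<epsilon> * \<bar>pushes p e\<bar> \<le> 1"
      using eps(2) by linarith
    then show ?thesis using eps by (simp add: abs_mult)
  qed
  have deg: "mdeg M v + \<epsilon> * raise_arcs p v \<le> c v" if "v \<in> U" for v
  proof (cases "raise_arcs p v = 0")
    case True
    then show ?thesis using mdeg_le that U by auto
  next
    case False
    then have "mdeg M v + 1 \<le> c v"
      using raise_arcs_pos[OF walk_arcs[OF p(1)], of v] by simp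
    moreover have "raise_arcs p v \<le> 2 * length p"
      using count_le_length[of p "(Root, 0, Pos v)"] count_le_length[of p "(Neg v, 0, Root)"]
      by (simp add: raise_arcs_def)
    then have "\<epsilon> * raise_arcs p v \<le> \<epsilon> * (2 * length p)"
      using eps by (intro mult_left_mono) auto
    ultimately show ?thesis using eps(3) by linarith
  qed
  have "0 \<le> \<epsilon>" using eps by simp
  note shifted = shifted_matching[OF U p(1) this small deg]
  have "0 < \<epsilon> * gain p" using eps p by simp
  then show ?thesis
    using shifted stable_iff_M_optimal[OF U] by force
qed

lemma finite_residual:
  assumes "U \<subseteq> V"
  shows "finite (R U)"
proof -
  let ?A = "{Root} \<union> Pos ` V \<union> Neg ` V" and ?W = "insert 0 (w ` E \<union> (\<lambda>e. - w e) ` E)"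
  have "R U \<subseteq> ?A \<times> ?W \<times> ?A"
  proof
    fix r assume "r \<in> R U"
    then show "r \<in> ?A \<times> ?W \<times> ?A"
      using assms M_sub by (cases rule: residual_arc_cases) auto
  qed
  moreover have "finite (?A \<times> ?W \<times> ?A)"
    using finite_V finite_E by simp
  ultimately show ?thesis by (rule finite_subset)
qed

text \<open>Pushing a small amount along a gainful walk beats \<open>M\<close>; without such a walk
  a potential exists and gives a dual solution of value \<open>sum w M\<close>.\<close>

theorem stable_iff_no_gainful_cycle:
  assumes "covered \<subseteq> U" "U \<subseteq> V"
  shows "stable U (induced_edges E U) w c \<longleftrightarrow> no_gainful_cycle (R U)"
proof
  assume "stable U (induced_edges E U) w c"
  then show "no_gainful_cycle (R U)"
    using gainful_cycle_unstable[OF assms] by (auto simp: no_gainful_cycle_def not_less[symmetric])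
next
  assume "no_gainful_cycle (R U)"
  then obtain f where "potential (R U) f"
    using no_gainful_cycle_potential finite_residual[OF assms(2)] by blast
  then show "stable U (induced_edges E U) w c"
    using stable_iff_M_optimal[OF assms] potential_M_optimal[OF assms] by blast
qed

section \<open>Integral augmentation and exposed vertices\<close>

lemma augmenting_cycle:
  assumes U: "covered \<subseteq> U" "U \<subseteq> V" and p: "walk (R U) u p u"
    and unit: "\<And>e. pushes p e \<in> {-1, 0, 1}"
    and deg: "\<And>v. v \<in> U \<Longrightarrow> mdeg M v + raise_arcs p v \<le> c v"
  shows "gain p \<le> 0"
proof -
  let ?F = "induced_edges E U"
  define x where "x e = of_bool (e \<in> M) + 1 * pushes p e" for e
  define N where "N = {e \<in> ?F. x e = 1}"
  have "\<bar>1 * pushes p e\<bar> \<le> 1" for e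
    using unit[of e] by auto
  moreover have "real (mdeg M v) + 1 * real (raise_arcs p v) \<le> real (c v)" if "v \<in> U" for v
    using deg[OF that] by linarith
  ultimately have x: "fractional_c_matching U ?F c x"
    "(\<Sum>e\<in>?F. w e * x e) = sum w M + 1 * gain p"
    using shifted_matching[OF U p zero_le_one] unfolding x_def by blast+
  \<comment> \<open>Membership in \<open>M\<close> plus a push of -1, 0 or 1 is an integer, and
    feasibility confines it to 0 and 1; so \<open>x\<close> is the indicator of a matching on
    \<open>?F\<close>.\<close>
  have x01: "x e = 0" if "e \<in> ?F" "e \<notin> N" for e
  proof -
    have "0 \<le> x e" "x e \<le> 1" using x(1) that by (auto simp: fractional_c_matching_def)
    then show ?thesis using that unit[of e] by (auto simp: N_def x_def)
  qed
  have N: "N \<subseteq> ?F" "\<And>e. e \<in> N \<Longrightarrow> x e = 1" by (auto simp: N_def)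
  have "c_matching U ?F c N"
    unfolding c_matching_def
  proof (intro conjI ballI)
    show "N \<subseteq> ?F" by (rule N(1))
    fix v assume "v \<in> U"
    have "real (card {e \<in> N. v \<in> e}) = (\<Sum>e | e \<in> N \<and> v \<in> e. 1)" by simp
    also have "\<dots> = (\<Sum>e | e \<in> ?F \<and> v \<in> e. x e)"
      using finite_induced[of U] x01 N by (intro sum.mono_neutral_cong_left) auto
    also have "\<dots> \<le> c v" using x(1) \<open>v \<in> U\<close> by (auto simp: fractional_c_matching_def)
    finally show "card {e \<in> N. v \<in> e} \<le> c v" by simp
  qed
  then have "sum w N \<le> sum w M"
    using induced_c_matching c_matching_weight_le by blast
  moreover have "sum w N = (\<Sum>e\<in>?F. w e * x e)"
    using finite_induced[of U] x01 N by (intro sum.mono_neutral_cong_left) auto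
  ultimately show ?thesis using x(2) by simp
qed

text \<open>No edge of \<open>M\<close> meets an exposed vertex, so away from \<open>Root\<close> no
  arc enters its \<open>Pos\<close> copy and none leaves its \<open>Neg\<close> copy. A walk
  avoiding \<open>Root\<close> can therefore meet it only by starting at \<open>Pos v\<close> or
  ending at \<open>Neg v\<close>.\<close>

lemma rootless_arc_verts:
  assumes q: "walk (R U) y q z" and rootless: "\<And>a. a \<in> set q \<Longrightarrow> fst a \<noteq> Root \<and> snd (snd a) \<noteq> Root"
    and a: "a \<in> set q" "v \<in> arc_verts a"
  shows "v \<in> covered \<or> (fst a = Pos v \<and> y = Pos v) \<or> (snd (snd a) = Neg v \<and> z = Neg v)"
proof -
  have del: "snd (snd b) = Pos u \<or> fst b = Neg u \<Longrightarrow> u \<in> covered" if "b \<in> set q" for b u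
  proof -
    have "b \<in> R U" using walk_arcs[OF q] that by blast
    then show "snd (snd b) = Pos u \<or> fst b = Neg u \<Longrightarrow> u \<in> covered"
      using rootless[OF that] matched_covered by (cases rule: residual_arc_cases) auto
  qed
  have fsts: "set (map fst q) \<subseteq> insert y (set (map (snd \<circ> snd) q))"
    and snds: "set (map (snd \<circ> snd) q) \<subseteq> insert z (set (map fst q))"
    using arg_cong[OF walk_nodes[OF q], of set] by auto
  have "a \<in> R U" using walk_arcs[OF q] a by blast
  then show ?thesis
  proof (cases rule: residual_arc_cases)
    case (add s t)
    then have "v = s \<or> v = t" using a by (auto simp: arc_verts_def)
    then show ?thesis
    proof
      assume "v = s"
      then have "Pos v \<in> set (map fst q)" using a add by force
      then have "Pos v \<in> insert y (set (map (snd \<circ> snd) q))" using fsts by blast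
      then have "y = Pos v \<or> (\<exists>b\<in>set q. snd (snd b) = Pos v)" by force
      then show ?thesis using del add \<open>v = s\<close> by auto
    next
      assume "v = t"
      then have "Neg v \<in> set (map (snd \<circ> snd) q)" using a add by force
      then have "Neg v \<in> insert z (set (map fst q))" using snds by blast
      then have "z = Neg v \<or> (\<exists>b\<in>set q. fst b = Neg v)" by force
      then show ?thesis using del add \<open>v = t\<close> by auto
    qed
  next
    case (del s t)
    then show ?thesis using a matched_covered by (auto simp: arc_verts_def)
  qed (use rootless[OF a(1)] in auto)
qed

lemma walk_restrict:
  assumes "walk (R U) x p y" "\<And>a. a \<in> set p \<Longrightarrow> arc_verts a \<subseteq> U'"
  shows "walk (R U') x p y"
proof (rule walk_mono[OF assms(1)], rule subsetI)
  fix a assume "a \<in> set p"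
  then show "a \<in> R U'"
    using walk_arcs[OF assms(1)] assms(2) by (intro residual_restrict[of a E w c M U U']) auto
qed

text \<open>If the walk repeats no edge, it augments \<open>M\<close>.  Otherwise it traverses some edge in both
  directions; closing up either end of the walk by its own mirror image yields two closed walks,
  each through one of the exposed vertices, of total gain \<open>2 * gain q\<close>.\<close>

lemma two_exposed_gain:
  assumes U: "covered \<subseteq> U" "U \<subseteq> V"
    and single: "\<And>v. v \<in> U \<Longrightarrow> no_gainful_cycle (R (insert v covered))"
    and uv: "u \<noteq> v" "u \<in> U - covered" "v \<in> U - covered"
    and ends: "(Root, 0, Pos v) \<in> R U" "(Neg u, 0, Root) \<in> R U"
    and q: "walk (R U) (Pos v) q (Neg u)" "distinct (map (snd \<circ> snd) q)"
    and rootless: "\<And>a. a \<in> set q \<Longrightarrow> fst a \<noteq> Root \<and> snd (snd a) \<noteq> Root"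
  shows "gain q \<le> 0"
proof (cases "\<exists>a\<in>set q. mirror_arc a \<in> set q")
  case True
  then obtain a where a: "a \<in> set q" "mirror_arc a \<in> set q" by blast
  \<comment> \<open>Away from \<open>Root\<close> a self-mirrored arc would join the two copies of
    one vertex and hence come from a loop.\<close>
  have "mirror_arc a \<noteq> a"
  proof -
    have loopless: "{x} \<notin> E" "{x} \<notin> M" for x
      using edge[of "{x}"] M_sub by auto
    have "a \<in> R U" using a walk_arcs[OF q(1)] by blast
    then show ?thesis
      using rootless[OF a(1)] by (cases rule: residual_arc_cases) (auto simp: mirror_arc_def loopless)
  qed
  obtain r s where rs: "q = r @ a # s" using a(1) by (meson split_list)
  \<comment> \<open>\<open>mirror_arc\<close> is an involution, so whichever lift is met first may
    be called \<open>b\<close> below.\<close>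
  have "\<exists>a q1 q2 q3. q = q1 @ a # q2 @ mirror_arc a # q3"
  proof (cases "mirror_arc a \<in> set s")
    case True
    then show ?thesis using rs by (metis split_list)
  next
    case False
    then have "mirror_arc a \<in> set r"
      using a(2) rs \<open>mirror_arc a \<noteq> a\<close> by auto
    then obtain q1 q2 where "r = q1 @ mirror_arc a # q2" by (meson split_list)
    then have "q = q1 @ mirror_arc a # q2 @ mirror_arc (mirror_arc a) # s" using rs by simp
    then show ?thesis by blast
  qed
  then obtain b q1 q2 q3 where qs: "q = q1 @ b # q2 @ mirror_arc b # q3" by blast
  have verts: "x \<in> covered \<or> (fst a = Pos v \<and> x = v) \<or> (snd (snd a) = Neg u \<and> x = u)"
    if "a \<in> set q" "x \<in> arc_verts a" for a x
    using rootless_arc_verts[OF q(1) rootless that] by auto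
  have w1: "walk (R U) (Pos v) q1 (fst b)" and w2: "walk (R U) (snd (snd b)) q2 (mirror (snd (snd b)))"
    and w3: "walk (R U) (mirror (fst b)) q3 (Neg u)" and bR: "b \<in> R U"
    using q(1) qs by (auto simp: walk_append)
  \<comment> \<open>\<open>v\<close> is exposed, so only \<open>Root\<close> has an arc to
    \<open>Pos v\<close>. The walk never returns to its start, and its tails are distinct as well as
    its heads.\<close>
  have "Pos v \<notin> set (map (snd \<circ> snd) q)"
  proof
    assume "Pos v \<in> set (map (snd \<circ> snd) q)"
    then obtain a where "a \<in> set q" "snd (snd a) = Pos v" by force
    moreover have "a \<in> R U" using \<open>a \<in> set q\<close> walk_arcs[OF q(1)] by blast
    then have "snd (snd a) = Pos v \<Longrightarrow> v \<in> covered"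
      using rootless[OF \<open>a \<in> set q\<close>] matched_covered by (cases rule: residual_arc_cases) auto
    ultimately show False using uv by auto
  qed
  then have "distinct (map fst q @ [Neg u])"
    using walk_nodes[OF q(1)] q(2) by simp
  then have dist_fst: "distinct (map fst q)" by simp
  \<comment> \<open>The last arc of \<open>q\<close> enters \<open>Neg u\<close>; as heads are
    distinct, this initial part avoids \<open>u\<close>.\<close>
  have left: "arc_verts a \<subseteq> insert v covered" if "a \<in> set (q1 @ b # q2)" for a
  proof -
    obtain r l where rl: "mirror_arc b # q3 = r @ [l]"
      by (metis append_butlast_last_id list.distinct(1))
    then have "q = (q1 @ b # q2) @ r @ [l]" using qs by simp
    then have "snd (snd l) = Neg u" "(snd \<circ> snd) l \<notin> (snd \<circ> snd) ` set (q1 @ b # q2)"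
      using q by (auto simp: walk_append)
    moreover have "(snd \<circ> snd) a \<in> (snd \<circ> snd) ` set (q1 @ b # q2)"
      using that by (rule imageI)
    ultimately have "snd (snd a) \<noteq> Neg u" by (metis comp_apply)
    then show ?thesis using verts[of a] that qs by auto
  qed
  \<comment> \<open>Dually, \<open>Pos v\<close> is the tail of the first arc of \<open>q\<close>
    only, so this final part avoids \<open>v\<close>.\<close>
  have right: "arc_verts a \<subseteq> insert u covered" if "a \<in> set (q2 @ mirror_arc b # q3)" for a
  proof -
    obtain f r where fr: "q1 @ [b] = f # r"
      by (metis append_is_Nil_conv list.exhaust list.distinct(1))
    then have "q = (f # r) @ (q2 @ mirror_arc b # q3)" using qs by (metis append.assoc append_Cons append_Nil)
    then have "fst f = Pos v" "fst f \<notin> fst ` set (q2 @ mirror_arc b # q3)"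
      using q(1) dist_fst by (auto simp: walk_append)
    moreover have "fst a \<in> fst ` set (q2 @ mirror_arc b # q3)"
      using that by (rule imageI)
    ultimately have "fst a \<noteq> Pos v" by metis
    then show ?thesis using verts[of a] that qs by auto
  qed
  have v: "(Root, 0, Pos v) \<in> R (insert v covered)" "(Neg u, 0, Root) \<in> R (insert u covered)"
    using residual_restrict[OF ends(1), of "insert v covered"]
      residual_restrict[OF ends(2), of "insert u covered"] by (simp_all add: arc_verts_def)
  then have v': "(Neg v, 0, Root) \<in> R (insert v covered)" "(Root, 0, Pos u) \<in> R (insert u covered)"
    using mirror_arc_residual[OF v(1)] mirror_arc_residual[OF v(2)]
    by (simp_all add: mirror_arc_def)
  \<comment> \<open>The final part contains the mirror of \<open>b\<close>, which has the same
    vertices as \<open>b\<close>.\<close>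
  have b1: "b \<in> R (insert v covered)" "b \<in> R (insert u covered)"
    using residual_restrict[OF bR] left[of b] right[of "mirror_arc b"] by auto
  then have b2: "mirror_arc b \<in> R (insert v covered)" "mirror_arc b \<in> R (insert u covered)"
    by (simp_all add: mirror_arc_residual)
  have w1': "walk (R (insert v covered)) (Pos v) q1 (fst b)"
    and w2v: "walk (R (insert v covered)) (snd (snd b)) q2 (mirror (snd (snd b)))"
    and w2u: "walk (R (insert u covered)) (snd (snd b)) q2 (mirror (snd (snd b)))"
    and w3': "walk (R (insert u covered)) (mirror (fst b)) q3 (Neg u)"
    using walk_restrict[OF w1] walk_restrict[OF w2] walk_restrict[OF w3] left right by auto
  \<comment> \<open>Out along \<open>q1\<close>, through both lifts of the repeated edge, back along
    the mirror of \<open>q1\<close>: gain \<open>2 * gain q1 + 2 * fst (snd b) + gain q2\<close>.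
    The walk through \<open>u\<close> below has \<open>q3\<close> in place of \<open>q1\<close>, and
    the two gains add up to \<open>2 * gain q\<close>.\<close>
  have "walk (R (insert v covered)) Root ((Root, 0, Pos v) # q1 @ b # q2 @ mirror_arc b #
      rev (map mirror_arc q1) @ [(Neg v, 0, Root)]) Root"
    using v v' b1 b2 w1' w2v walk_mirror[OF w1'] by (auto simp: walk_append)
  then have "gain ((Root, 0, Pos v) # q1 @ b # q2 @ mirror_arc b #
      rev (map mirror_arc q1) @ [(Neg v, 0, Root)]) \<le> 0"
    using single[of v] uv unfolding no_gainful_cycle_def by blast
  moreover have "walk (R (insert u covered)) Root ((Root, 0, Pos u) # rev (map mirror_arc q3) @ b # q2 @
      mirror_arc b # q3 @ [(Neg u, 0, Root)]) Root"
    using v v' b1 b2 w3' w2u walk_mirror[OF w3'] by (auto simp: walk_append)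
  then have "gain ((Root, 0, Pos u) # rev (map mirror_arc q3) @ b # q2 @
      mirror_arc b # q3 @ [(Neg u, 0, Root)]) \<le> 0"
    using single[of u] uv unfolding no_gainful_cycle_def by blast
  ultimately show ?thesis
    by (simp add: qs gain_mirror)
next
  case False
  define p where "p = (Root, 0, Pos v) # q @ [(Neg u, 0, Root)]"
  have p: "walk (R U) Root p Root"
    using ends q by (auto simp: p_def walk_append)
  have notin: "(Root, 0, x) \<notin> set q" "(x, 0, Root) \<notin> set q" for x
    using rootless[of "(Root, 0, x)"] rootless[of "(x, 0, Root)"] by auto
  have "distinct q" using q(2) by (simp add: distinct_map)
  then have "distinct p" using notin by (auto simp: p_def)
  have "push a e = 0" if "a \<in> set p" "mirror_arc a \<in> set p" for a e
  proof (cases "a \<in> set q")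
    case True
    then have "mirror_arc a \<notin> set q" using False by blast
    then have "mirror_arc a = (Root, 0, Pos v) \<or> mirror_arc a = (Neg u, 0, Root)"
      using that(2) by (auto simp: p_def)
    then have "mirror (snd (snd a)) = Root \<or> mirror (fst a) = Root"
      by (auto simp: mirror_arc_def)
    then have "fst a = Root \<or> snd (snd a) = Root" by (metis mirror.simps(1) mirror_mirror)
    then show ?thesis using rootless[OF True] by blast
  qed (use that in \<open>auto simp: p_def\<close>)
  then have unit: "pushes p e \<in> {-1, 0, 1}" for e
    using pushes_no_repeated_edge[OF walk_arcs[OF p] \<open>distinct p\<close>] by blast
  \<comment> \<open>Since \<open>u \<noteq> v\<close>, each end is raised by one unit only, and the
    arcs at \<open>Root\<close> guarantee that much spare capacity.\<close>
  have raise: "raise_arcs p x = of_bool (x = v) + of_bool (x = u)" for x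
    using notin by (auto simp: raise_arcs_def p_def)
  have "mdeg M x + raise_arcs p x \<le> c x" if "x \<in> U" for x
  proof (cases "raise_arcs p x = 0")
    case True
    then show ?thesis using mdeg_le that U by auto
  next
    case False
    then have "raise_arcs p x = 1" using raise uv by auto
    then show ?thesis using raise_arcs_pos[OF walk_arcs[OF p], of x] by simp
  qed
  then have "gain p \<le> 0" using augmenting_cycle[OF U p unit] by blast
  then show ?thesis by (simp add: p_def)
qed

text \<open>A simple closed walk passes \<open>Root\<close> at most once. What remains avoids
  \<open>Root\<close>, so by \<open>rootless_arc_verts\<close> exposed vertices occur only at its
  two ends.\<close>

theorem no_gainful_cycle_singles:
  assumes U: "covered \<subseteq> U" "U \<subseteq> V"
    and single: "\<And>v. v \<in> U \<Longrightarrow> no_gainful_cycle (R (insert v covered))"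
  shows "no_gainful_cycle (R U)"
proof (rule ccontr)
  have contra: False if "walk (R U) x p x" "0 < gain p" "v \<in> U"
    "\<And>a. a \<in> set p \<Longrightarrow> arc_verts a \<subseteq> insert v covered" for x p v
  proof -
    have "walk (R (insert v covered)) x p x" using walk_restrict that(1,4) by blast
    then show False using single[OF that(3)] that(2) unfolding no_gainful_cycle_def by fastforce
  qed
  assume "\<not> no_gainful_cycle (R U)"
  then obtain x p where p: "walk (R U) x p x" "0 < gain p" "distinct (map (snd \<circ> snd) p)"
    using simple_gainful_cycle by blast
  show False
  proof (cases "Root \<in> (snd \<circ> snd) ` set p")
    case False
    have "p \<noteq> []" using p(2) by auto
    then obtain p' b where "p = p' @ [b]" by (metis append_butlast_last_id)
    then have b: "b \<in> set p" "snd (snd b) = x" using p(1) by (auto simp: walk_append)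
    have "set (map fst p) \<subseteq> insert x (set (map (snd \<circ> snd) p))"
      using arg_cong[OF walk_nodes[OF p(1)], of set] by auto
    then have "Root \<notin> set (map fst p)" using False b by auto
    then have rootless: "fst a \<noteq> Root \<and> snd (snd a) \<noteq> Root" if "a \<in> set p" for a
      using False that by force
    then have "x \<noteq> Root" using b by blast
    \<comment> \<open>\<open>v\<close> may be covered or exposed; in both cases
      \<open>insert v covered\<close> contains the whole walk.\<close>
    then obtain v where v: "x = Pos v \<or> x = Neg v" by (cases x) auto
    have "v \<in> arc_verts b" using b v by (auto simp: arc_verts_def)
    then have "v \<in> U" using residual_verts[of b E w c M U] walk_arcs[OF p(1)] b by blast
    then show False
    proof (rule contra[OF p(1,2)])
      fix a assume "a \<in> set p"
      then show "arc_verts a \<subseteq> insert v covered"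
        using rootless_arc_verts[OF p(1) rootless] v by blast
    qed
  next
    case True
    then obtain p where p: "walk (R U) Root p Root" "0 < gain p" "distinct (map (snd \<circ> snd) p)"
      using rotate_cycle[OF p(1)] p(2,3) by metis
    obtain a p' where a: "p = a # p'" using p(2) by (cases p) auto
    have aR: "a \<in> R U" "fst a = Root" using p(1) a by auto
    have "p' \<noteq> []"
      using p(1) a aR by (auto elim: residual_arc_cases)
    then obtain q b where q: "p' = q @ [b]" by (metis append_butlast_last_id)
    have bR: "b \<in> R U" "snd (snd b) = Root" and wq: "walk (R U) (snd (snd a)) q (fst b)"
      using p(1) a q by (auto simp: walk_append)
    have noRoot: "Root \<notin> set (map (snd \<circ> snd) (a # q))" and dq: "distinct (map (snd \<circ> snd) q)"
      using p(3) a q bR by auto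
    have "set (map fst q) \<subseteq> insert (snd (snd a)) (set (map (snd \<circ> snd) q))"
      using arg_cong[OF walk_nodes[OF wq], of set] by auto
    then have "Root \<notin> set (map fst q)" using noRoot by auto
    then have rootless: "fst d \<noteq> Root \<and> snd (snd d) \<noteq> Root" if "d \<in> set q" for d
      using noRoot that by force
    \<comment> \<open>Arcs from \<open>Root\<close> to \<open>Neg v\<close> require positive degree,
      so an exposed vertex is entered from \<open>Root\<close> as \<open>Pos v\<close>; dually for
      \<open>b\<close> below.\<close>
    obtain v where v: "v \<in> U" "a = (Root, 0, Pos v) \<or> a = (Root, 0, Neg v) \<and> v \<in> covered"
      using aR U(2) by (cases rule: residual_arc_cases[OF aR(1)]) (auto simp: covered_def)
    obtain u where u: "u \<in> U" "b = (Neg u, 0, Root) \<or> b = (Pos u, 0, Root) \<and> u \<in> covered"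
      using bR U(2) by (cases rule: residual_arc_cases[OF bR(1)]) (auto simp: covered_def)
    have verts: "arc_verts d \<subseteq> {u, v} \<union> covered" if "d \<in> set p" for d
    proof (cases "d \<in> set q")
      case True
      show ?thesis
      proof
        fix x assume "x \<in> arc_verts d"
        from rootless_arc_verts[OF wq rootless True this] show "x \<in> {u, v} \<union> covered"
          using u(2) v(2) by auto
      qed
    next
      case False
      then show ?thesis using that a q u v by (auto simp: arc_verts_def)
    qed
    show False
    proof (cases "u = v \<or> u \<in> covered \<or> v \<in> covered")
      case True
      then have "\<exists>x\<in>U. {u, v} \<union> covered \<subseteq> insert x covered" using u v by auto
      then show False using contra[OF p(1,2)] verts by (metis subset_trans)
    next
      case False
      then have ab: "a = (Root, 0, Pos v)" "b = (Neg u, 0, Root)" using u v by auto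
      then have "gain q \<le> 0"
        using two_exposed_gain[OF U single, of u v q] False u v aR bR wq dq rootless by auto
      then show False using p(2) a q ab by simp
    qed
  qed
qed

section \<open>The least stabilizer\<close>

lemma M_vertex_stabilizer_iff:
  "M_vertex_stabilizer V E w c M S \<longleftrightarrow>
    S \<subseteq> V \<and> S \<inter> covered = {} \<and> no_gainful_cycle (R (V - S))"
proof -
  have "M \<subseteq> induced_edges E (V - S) \<Longrightarrow> S \<inter> covered = {}"
  proof (rule ccontr)
    assume M: "M \<subseteq> induced_edges E (V - S)" and "S \<inter> covered \<noteq> {}"
    then obtain v where "v \<in> S" "0 < mdeg M v" by (auto simp: covered_def)
    then obtain e where "e \<in> M" "v \<in> e" by (auto simp: mdeg_def card_gt_0_iff)
    then show False using M \<open>v \<in> S\<close> by (auto simp: induced_edges_def)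
  qed
  then show ?thesis
    using stable_iff_no_gainful_cycle[of "V - S"] c_matching_M[of "V - S"] covered_sub
    unfolding M_vertex_stabilizer_def vertex_stabilizer_def c_matching_def by blast
qed

definition forced :: "'a set" where
  "forced = {v \<in> V - covered. \<not> no_gainful_cycle (R (insert v covered))}"

theorem no_stabilizer:
  assumes "\<not> no_gainful_cycle (R covered)"
  shows "\<not> M_vertex_stabilizer V E w c M S"
proof
  assume "M_vertex_stabilizer V E w c M S"
  then have "no_gainful_cycle (R (V - S))" "covered \<subseteq> V - S"
    using covered_sub by (auto simp: M_vertex_stabilizer_iff)
  then show False
    using assms no_gainful_cycle_mono residual_mono by metis
qed

theorem forced_minimum:
  assumes "no_gainful_cycle (R covered)"
  shows "min_M_vertex_stabilizer V E w c M forced"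
  unfolding min_M_vertex_stabilizer_def
proof (intro conjI allI impI)
  have "no_gainful_cycle (R (V - forced))"
  proof (rule no_gainful_cycle_singles)
    fix v assume "v \<in> V - forced"
    then show "no_gainful_cycle (R (insert v covered))"
      using assms by (cases "v \<in> covered") (auto simp: forced_def insert_absorb)
  qed (use covered_sub in \<open>auto simp: forced_def\<close>)
  then show "M_vertex_stabilizer V E w c M forced"
    by (auto simp: M_vertex_stabilizer_iff forced_def)
next
  fix T assume T: "M_vertex_stabilizer V E w c M T"
  \<comment> \<open>Covered vertices may not be deleted, so keeping a forced \<open>v\<close> keeps
    all of \<open>insert v covered\<close> and with it a gainful walk.\<close>
  have "forced \<subseteq> T"
  proof
    fix v assume v: "v \<in> forced"
    show "v \<in> T"
    proof (rule ccontr)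
      assume "v \<notin> T"
      then have "insert v covered \<subseteq> V - T"
        using v T covered_sub by (auto simp: M_vertex_stabilizer_iff forced_def)
      then have "no_gainful_cycle (R (insert v covered))"
        using T no_gainful_cycle_mono residual_mono by (metis M_vertex_stabilizer_iff)
      then show False using v by (simp add: forced_def)
    qed
  qed
  moreover have "finite T"
    using T finite_V finite_subset by (auto simp: M_vertex_stabilizer_iff)
  ultimately show "card forced \<le> card T" by (simp add: card_mono)
qed

end

section \<open>Running programs within a time bound\<close>

text \<open>Total correctness with a cost bound. Execution is deterministic, so one halting
  execution describes them all.\<close>

definition runs :: "com \<Rightarrow> state \<Rightarrow> nat \<Rightarrow> (state \<Rightarrow> bool) \<Rightarrow> bool" where
  "runs p s T Q \<longleftrightarrow> (\<exists>t s'. exec p s t s' \<and> t \<le> T \<and> Q s')"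

lemma runs_weaken:
  "runs p s T Q \<Longrightarrow> T \<le> T' \<Longrightarrow> (\<And>s'. Q s' \<Longrightarrow> Q' s') \<Longrightarrow> runs p s T' Q'"
  unfolding runs_def using le_trans by blast

lemma runs_Seq:
  assumes "runs p s T Q" "\<And>s'. Q s' \<Longrightarrow> runs q s' T' Q'"
  shows "runs (Seq p q) s (T + T') Q'"
  using assms unfolding runs_def by (meson add_mono exec_Seq)

lemma runs_Cond:
  assumes "bval b s \<Longrightarrow> runs p s T Q" "\<not> bval b s \<Longrightarrow> runs q s T Q"
  shows "runs (Cond b p q) s (T + 1) Q"
  using assms unfolding runs_def by (meson add_le_cancel_right exec_CondF exec_CondT)

fun loop_free :: "com \<Rightarrow> bool" where
  "loop_free (Seq p q) \<longleftrightarrow> loop_free p \<and> loop_free q"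
| "loop_free (Cond b p q) \<longleftrightarrow> loop_free p \<and> loop_free q"
| "loop_free (While b p) \<longleftrightarrow> False"
| "loop_free _ \<longleftrightarrow> True"

text \<open>The value on loops is irrelevant.\<close>

fun run :: "com \<Rightarrow> state \<Rightarrow> state" where
  "run Skip s = s"
| "run (NAssign a i x) s = (upd (fst s) a (nval i s) (nval x s), snd s)"
| "run (RAssign a i x) s = (fst s, upd (snd s) a (nval i s) (rval x s))"
| "run (Seq p q) s = run q (run p s)"
| "run (Cond b p q) s = (if bval b s then run p s else run q s)"
| "run (While b p) s = s"

text \<open>Counting both branches of a conditional gives a bound independent of the state instead
  of the exact cost.\<close>

fun steps :: "com \<Rightarrow> nat" where
  "steps (Seq p q) = steps p + steps q"
| "steps (Cond b p q) = steps p + steps q + 1"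
| "steps _ = 1"

lemma exec_run: "loop_free p \<Longrightarrow> \<exists>t \<le> steps p. exec p s t (run p s)"
proof (induction p arbitrary: s)
  case (Seq p q)
  then obtain t t' where "t \<le> steps p" "exec p s t (run p s)"
    "t' \<le> steps q" "exec q (run p s) t' (run q (run p s))"
    by (metis loop_free.simps(1))
  then show ?case
    using exec_Seq by (intro exI[of _ "t + t'"]) auto
next
  case (Cond b p q)
  then obtain t t' where "t \<le> steps p" "exec p s t (run p s)"
    "t' \<le> steps q" "exec q s t' (run q s)"
    by (metis loop_free.simps(2))
  then show ?case
    using exec_CondT[of b s p t "run p s" q] exec_CondF[of b s q t' "run q s" p]
    by (intro exI[of _ "if bval b s then t + 1 else t' + 1"]) auto
next
  case Skip
  show ?case unfolding run.simps steps.simps by (blast intro: exec_Skip order_refl)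
next
  case NAssign
  show ?case unfolding run.simps steps.simps by (blast intro: exec_NAssign order_refl)
next
  case RAssign
  show ?case unfolding run.simps steps.simps by (blast intro: exec_RAssign order_refl)
qed simp

lemma runs_run: "loop_free p \<Longrightarrow> Q (run p s) \<Longrightarrow> runs p s (steps p) Q"
  unfolding runs_def using exec_run by blast

definition for_loop :: "nat \<Rightarrow> nexp \<Rightarrow> com \<Rightarrow> com" where
  "for_loop k b p = Seq (NAssign k (NConst 0) (NConst 0))
     (While (NLess (NCell k (NConst 0)) b)
       (Seq p (NAssign k (NConst 0) (NAdd (NCell k (NConst 0)) (NConst 1)))))"

lemma upd_apply [simp]: "upd m a i x b = (if b = a then (m a)(i := x) else m b)"
  by (simp add: upd_def)

text \<open>\<open>T + 2\<close> pays for the body, the test and the increment; the final 2 pays for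
  the initialisation and the failing test. The invariant receives the index as an argument and has
  to tolerate any value in the counter cell.\<close>

lemma runs_for_loop:
  assumes init: "I 0 s"
    and counter: "\<And>i s x. I i s \<Longrightarrow> I i (upd (fst s) k 0 x, snd s)"
    and bound: "\<And>i s. I i s \<Longrightarrow> nval b s = N"
    and body: "\<And>i s. I i s \<Longrightarrow> fst s k 0 = i \<Longrightarrow> i < N \<Longrightarrow>
      runs p s T (\<lambda>s'. I (Suc i) s' \<and> fst s' k 0 = i)"
  shows "runs (for_loop k b p) s (N * (T + 2) + 2) (I N)"
proof -
  let ?q = "Seq p (NAssign k (NConst 0) (NAdd (NCell k (NConst 0)) (NConst 1)))"
  let ?w = "While (NLess (NCell k (NConst 0)) b) ?q"
  have loop: "runs ?w s (j * (T + 2) + 1) (I N)" if "I i s" "fst s k 0 = i" "i + j = N" for i j s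
    using that
  proof (induction j arbitrary: i s)
    case 0
    then have "\<not> bval (NLess (NCell k (NConst 0)) b) s" using bound by simp
    from exec_WhileF[OF this, of ?q] show ?case
      unfolding runs_def using 0 by (intro exI[of _ 1] exI[of _ s]) auto
  next
    case (Suc j)
    then have b: "bval (NLess (NCell k (NConst 0)) b) s" using bound by simp
    obtain t s' where p: "exec p s t s'" "t \<le> T" "I (Suc i) s'" "fst s' k 0 = i"
      using body[OF Suc.prems(1,2)] Suc.prems(3) by (auto simp: runs_def)
    let ?s = "(upd (fst s') k 0 (Suc i), snd s')"
    have q: "exec ?q s (t + 1) ?s"
      using exec_Seq[OF p(1) exec_NAssign[of k "NConst 0" "NAdd (NCell k (NConst 0)) (NConst 1)"]] p(4)
      by simp
    have "runs ?w ?s (j * (T + 2) + 1) (I N)"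
      using Suc.prems(3) counter[OF p(3)] by (intro Suc.IH[of "Suc i"]) auto
    then obtain t' s'' where "exec ?w ?s t' s''" "t' \<le> j * (T + 2) + 1" "I N s''"
      by (auto simp: runs_def)
    then show ?case
      using exec_WhileT[OF b q] p(2) unfolding runs_def
      by (intro exI[of _ "t + 1 + t' + 1"] exI[of _ s'']) auto
  qed
  have "runs (NAssign k (NConst 0) (NConst 0)) s 1 (\<lambda>s'. I 0 s' \<and> fst s' k 0 = 0)"
    using runs_run[of "NAssign k (NConst 0) (NConst 0)" "\<lambda>s'. I 0 s' \<and> fst s' k 0 = 0" s]
      counter[OF init] by simp
  then have "runs (for_loop k b p) s (1 + (N * (T + 2) + 1)) (I N)"
    unfolding for_loop_def by (rule runs_Seq) (use loop in auto)
  then show ?thesis by (rule runs_weaken) auto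
qed

text \<open>Of the real memory only the weights are protected, as relaxations overwrite the
  labels.\<close>

definition unchanged :: "nat set \<Rightarrow> state \<Rightarrow> state \<Rightarrow> bool" where
  "unchanged A s s' \<longleftrightarrow> (\<forall>a. a \<notin> A \<longrightarrow> fst s' a = fst s a) \<and> snd s' 0 = snd s 0"

lemma unchanged_refl [simp]: "unchanged A s s"
  by (simp add: unchanged_def)

lemma unchanged_mono: "unchanged A s s' \<Longrightarrow> A \<subseteq> B \<Longrightarrow> unchanged B s s'"
  by (auto simp: unchanged_def)

lemma unchanged_trans:
  "unchanged A s s' \<Longrightarrow> unchanged B s' s'' \<Longrightarrow> A \<subseteq> C \<Longrightarrow> B \<subseteq> C \<Longrightarrow> unchanged C s s''"
  unfolding unchanged_def by (metis subsetD)

section \<open>The program\<close>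

text \<open>Natural number arrays 8, 9 and 10 hold the capacities, the degrees in \<open>M\<close> and a flag for the
  vertices currently present, all indexed by vertex label; 11, 12 and 13 hold loop counters and
  14 the flag of a pass.  Real arrays 1, 2 and 3 hold the labels of \<open>Pos v\<close>, \<open>Neg v\<close> and \<open>Root\<close>.\<close>

fun addr :: "'i node \<Rightarrow> 'i \<Rightarrow> nat \<times> 'i" where
  "addr Root z = (3, z)" | "addr (Pos i) z = (1, i)" | "addr (Neg i) z = (2, i)"

definition node_cell :: "nexp node \<Rightarrow> rexp" where
  "node_cell x = RCell (fst (addr x (NConst 0))) (snd (addr x (NConst 0)))"

text \<open>\<open>G\<close> turns the label expression of the tail into the candidate label of the
  head, so one scheme serves arcs that add a weight, subtract one or have gain 0.\<close>

definition relax_com :: "nexp node \<Rightarrow> (rexp \<Rightarrow> rexp) \<Rightarrow> nexp node \<Rightarrow> com" where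
  "relax_com x G y = Cond (RLess (node_cell y) (G (node_cell x)))
     (Seq (RAssign (fst (addr y (NConst 0))) (snd (addr y (NConst 0))) (G (node_cell x)))
       (NAssign 14 (NConst 0) (NConst 1)))
     Skip"

definition positive :: "nexp \<Rightarrow> bexp" where
  "positive x = NLess (NConst 0) x"

abbreviation counter :: "nat \<Rightarrow> nexp" where
  "counter k \<equiv> NCell k (NConst 0)"

abbreviation num_vertices :: nexp where
  "num_vertices \<equiv> NCell 0 (NConst 0)"

abbreviation num_edges :: nexp where
  "num_edges \<equiv> NCell 0 (NConst 1)"

definition edge_com :: com where
  "edge_com = (let a = NCell 3 (counter 13); b = NCell 4 (counter 13); g = RCell 0 (counter 13) in
     Cond (BAnd (positive (NCell 10 a)) (positive (NCell 10 b)))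
       (Cond (positive (NCell 5 (counter 13)))
         (Seq (relax_com (Neg a) (\<lambda>r. RSub r g) (Pos b)) (relax_com (Neg b) (\<lambda>r. RSub r g) (Pos a)))
         (Seq (relax_com (Pos a) (\<lambda>r. RAdd r g) (Neg b)) (relax_com (Pos b) (\<lambda>r. RAdd r g) (Neg a))))
       Skip)"

definition vertex_com :: com where
  "vertex_com = (let v = NCell 1 (counter 13) in
     Cond (positive (NCell 10 v))
       (Seq
         (Cond (NLess (NCell 9 v) (NCell 8 v))
           (Seq (relax_com Root (\<lambda>r. r) (Pos v)) (relax_com (Neg v) (\<lambda>r. r) Root)) Skip)
         (Cond (positive (NCell 9 v))
           (Seq (relax_com (Pos v) (\<lambda>r. r) Root) (relax_com Root (\<lambda>r. r) (Neg v))) Skip))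
       Skip)"

definition pass_com :: com where
  "pass_com = Seq (NAssign 14 (NConst 0) (NConst 0))
     (Seq (for_loop 13 num_edges edge_com) (for_loop 13 num_vertices vertex_com))"

text \<open>With \<open>n\<close> vertices there are \<open>2 * n + 1\<close> nodes:
  \<open>2 * n\<close> sweeps reach a potential if there is one, and one more sets the flag. Labels
  left by an earlier test need no clearing, because starting labels are arbitrary.\<close>

definition test_com :: com where
  "test_com = for_loop 12 (NAdd (NAdd num_vertices num_vertices) (NConst 1)) pass_com"

definition capacity_com :: com where
  "capacity_com = NAssign 8 (NCell 1 (counter 13)) (NCell 2 (counter 13))"

definition degree_com :: com where
  "degree_com = (let a = NCell 3 (counter 13); b = NCell 4 (counter 13) in
     Cond (positive (NCell 5 (counter 13)))
       (Seq (NAssign 9 a (NAdd (NCell 9 a) (NConst 1))) (NAssign 9 b (NAdd (NCell 9 b) (NConst 1))))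
       Skip)"

text \<open>The degree itself serves as the flag, being positive exactly on the covered
  vertices.\<close>

definition present_com :: com where
  "present_com = NAssign 10 (NCell 1 (counter 13)) (NCell 9 (NCell 1 (counter 13)))"

definition setup_com :: com where
  "setup_com = Seq (for_loop 13 num_vertices capacity_com)
     (Seq (for_loop 13 num_edges degree_com) (for_loop 13 num_vertices present_com))"

definition candidate_com :: com where
  "candidate_com = (let v = NCell 1 (counter 11) in
     Cond (positive (NCell 9 v)) Skip
       (Seq (NAssign 10 v (NConst 1))
         (Seq test_com
           (Seq (NAssign 7 (counter 11) (counter 14)) (NAssign 10 v (NConst 0))))))"

definition main_com :: com where
  "main_com = Seq setup_com (Seq test_com
     (Cond (positive (counter 14)) Skip
       (Seq (NAssign 6 (NConst 0) (NConst 1)) (for_loop 11 num_vertices candidate_com))))"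

text \<open>Here and below, sums keep the shape in which \<open>runs_Seq\<close>,
  \<open>runs_Cond\<close> and \<open>runs_for_loop\<close> compose bounds.\<close>

definition pass_time :: "nat \<Rightarrow> nat \<Rightarrow> nat" where
  "pass_time n m = 1 + ((m * (steps edge_com + 2) + 2) + (n * (steps vertex_com + 2) + 2))"

definition test_time :: "nat \<Rightarrow> nat \<Rightarrow> nat" where
  "test_time n m = (n + n + 1) * (pass_time n m + 2) + 2"

definition setup_time :: "nat \<Rightarrow> nat \<Rightarrow> nat" where
  "setup_time n m = (n * (1 + 2) + 2) + ((m * (steps degree_com + 2) + 2) + (n * (1 + 2) + 2))"

definition candidate_time :: "nat \<Rightarrow> nat \<Rightarrow> nat" where
  "candidate_time n m = 1 + (test_time n m + 2) + 1"

definition main_time :: "nat \<Rightarrow> nat \<Rightarrow> nat" where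
  "main_time n m = setup_time n m +
     (test_time n m + (1 + (n * (candidate_time n m + 2) + 2) + 1))"

section \<open>Machine memory as Bellman-Ford labels\<close>

definition labels :: "state \<Rightarrow> nat node \<Rightarrow> real" where
  "labels s x = snd s (fst (addr x 0)) (snd (addr x 0))"

definition pass_state :: "state \<Rightarrow> (nat node \<Rightarrow> real) \<times> bool" where
  "pass_state s = (labels s, fst s 14 0 \<noteq> 0)"

lemma bval_positive [simp]: "bval (positive x) s \<longleftrightarrow> 0 < nval x s"
  by (simp add: positive_def)

lemma loop_free_relax_com [simp]: "loop_free (relax_com x G y)"
  by (simp add: relax_com_def)

lemma rval_node_cell: "rval (node_cell x) s = labels s (map_node (\<lambda>i. nval i s) x)"
  by (cases x) (auto simp: node_cell_def labels_def)

lemma labels_snd [simp]: "labels (N, snd s) = labels s"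
  by (simp add: labels_def fun_eq_iff)

text \<open>\<open>addr\<close> sends different nodes to different cells, so a write changes a
  single label. \<open>N\<close> and \<open>N'\<close> are arbitrary because labels live in real
  memory.\<close>

lemma labels_upd:
  "labels (N, upd D (fst (addr x 0)) (snd (addr x 0)) r) = (labels (N', D))(x := r)"
proof
  fix y
  show "labels (N, upd D (fst (addr x 0)) (snd (addr x 0)) r) y = ((labels (N', D))(x := r)) y"
    by (cases x; cases y) (auto simp: labels_def)
qed

lemma run_relax_com:
  assumes G: "\<And>r. rval (G r) s = rval r s + g"
  shows "pass_state (run (relax_com x G y) s) =
      relax (map_node (\<lambda>i. nval i s) x, g, map_node (\<lambda>i. nval i s) y) (pass_state s)"
    and "unchanged {14} s (run (relax_com x G y) s)"
proof -
  let ?n = "map_node (\<lambda>i. nval i s)"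
  have addr: "fst (addr (?n y) 0) = fst (addr y (NConst 0))"
    "snd (addr (?n y) 0) = nval (snd (addr y (NConst 0))) s"
    by (cases y; simp)+
  show "pass_state (run (relax_com x G y) s) = relax (?n x, g, ?n y) (pass_state s)"
    using labels_upd[of _ "snd s" "?n y" _ "fst s"]
    by (simp add: relax_com_def pass_state_def rval_node_cell G addr labels_def)
  show "unchanged {14} s (run (relax_com x G y) s)"
    by (cases y) (auto simp: relax_com_def unchanged_def)
qed

text \<open>The second relaxation starts in a state altered by the first. Values are required to
  survive changes of array 14, the only natural number array a relaxation writes, so one
  \<open>h\<close> evaluates the indices of both.\<close>

lemma run_relax_pair:
  assumes G: "\<And>s' r. unchanged {14} s s' \<Longrightarrow> rval (G r) s' = rval r s' + g"
    and h: "\<And>s' i. unchanged {14} s s' \<Longrightarrow>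
      i \<in> set_node x \<union> set_node y \<union> set_node x' \<union> set_node y' \<Longrightarrow> nval i s' = h i"
  shows "pass_state (run (Seq (relax_com x G y) (relax_com x' G y')) s) =
      fold relax [(map_node h x, g, map_node h y), (map_node h x', g, map_node h y')] (pass_state s)"
    and "unchanged {14} s (run (Seq (relax_com x G y) (relax_com x' G y')) s)"
proof -
  let ?s = "run (relax_com x G y) s"
  have u: "unchanged {14} s ?s" by (rule run_relax_com(2)[OF G]) simp
  then have "unchanged {14} ?s (run (relax_com x' G y') ?s)"
    by (intro run_relax_com(2)[OF G[OF u]])
  then show "unchanged {14} s (run (Seq (relax_com x G y) (relax_com x' G y')) s)"
    using u unchanged_trans by fastforce
  have "map_node (\<lambda>i. nval i s) x = map_node h x" "map_node (\<lambda>i. nval i s) y = map_node h y"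
    "map_node (\<lambda>i. nval i ?s) x' = map_node h x'" "map_node (\<lambda>i. nval i ?s) y' = map_node h y'"
    using h[OF unchanged_refl] h[OF u] by (auto intro!: node.map_cong)
  then show "pass_state (run (Seq (relax_com x G y) (relax_com x' G y')) s) =
      fold relax [(map_node h x, g, map_node h y), (map_node h x', g, map_node h y')] (pass_state s)"
    using run_relax_com(1)[of G s g x y, OF G] run_relax_com(1)[of G ?s g x' y', OF G[OF u]] by simp
qed

lemma pass_state_counter: "pass_state (upd (fst s) k 0 x, snd s) = pass_state s" if "k \<noteq> 14"
  using that by (auto simp: pass_state_def labels_def)

lemma unchanged_counter: "unchanged A s s' \<Longrightarrow> k \<in> A \<Longrightarrow> unchanged A s (upd (fst s') k 0 x, snd s')"
  by (auto simp: unchanged_def)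

section \<open>The program on an encoded graph\<close>

locale encoded_graph = matched_graph V E w c M
  for V :: "nat set" and E :: "nat set set" and w :: "nat set \<Rightarrow> real" and c :: "nat \<Rightarrow> nat"
    and M :: "nat set set" +
  fixes vs :: "nat list" and es :: "(nat \<times> nat) list"
  assumes rep: "represents vs es V E"
begin

lemma vs: "distinct vs" "set vs = V" and es: "distinct (map uedge es)" "uedge ` set es = E"
  using rep by (auto simp: represents_def)

lemma nth_vs: "i < length vs \<Longrightarrow> vs ! i \<in> V"
  using vs by auto

lemma nth_es:
  assumes "j < length es"
  shows "uedge (es ! j) \<in> E" "fst (es ! j) \<in> V" "snd (es ! j) \<in> V" "fst (es ! j) \<noteq> snd (es ! j)"
proof -
  show "uedge (es ! j) \<in> E" using es assms by auto
  then show "fst (es ! j) \<in> V" "snd (es ! j) \<in> V" "fst (es ! j) \<noteq> snd (es ! j)"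
    using edge[of "uedge (es ! j)"] by (auto simp: uedge_def)
qed

definition edge_arcs :: "nat set \<Rightarrow> nat \<times> nat \<Rightarrow> nat node arc list" where
  "edge_arcs U p = (let a = fst p; b = snd p; g = w (uedge p) in
     if a \<in> U \<and> b \<in> U then
       if uedge p \<in> M then [(Neg a, - g, Pos b), (Neg b, - g, Pos a)]
       else [(Pos a, g, Neg b), (Pos b, g, Neg a)]
     else [])"

definition vertex_arcs :: "nat set \<Rightarrow> nat \<Rightarrow> nat node arc list" where
  "vertex_arcs U v = (if v \<in> U then
     (if mdeg M v < c v then [(Root, 0, Pos v), (Neg v, 0, Root)] else []) @
     (if 0 < mdeg M v then [(Pos v, 0, Root), (Root, 0, Neg v)] else []) else [])"

text \<open>The order is that of \<open>pass_com\<close>; it matters because sweeps update in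
  place.\<close>

definition arcs :: "nat set \<Rightarrow> nat node arc list" where
  "arcs U = concat (map (edge_arcs U) es) @ concat (map (vertex_arcs U) vs)"

lemma set_arcs:
  assumes "U \<subseteq> V"
  shows "set (arcs U) = R U"
proof
  have "r \<in> R U" if "p \<in> set es" "r \<in> set (edge_arcs U p)" for p r
  proof -
    have "uedge p \<in> E" using es that by auto
    then show ?thesis
      using that residual.add[of "fst p" "snd p" E M U w c] residual.add[of "snd p" "fst p" E M U w c]
        residual.del[of "fst p" "snd p" M U w E c] residual.del[of "snd p" "fst p" M U w E c]
      by (auto simp: edge_arcs_def Let_def uedge_def insert_commute split: if_splits)
  qed
  moreover have "r \<in> R U" if "r \<in> set (vertex_arcs U v)" for v r
    using that by (auto simp: vertex_arcs_def intro: residual.intros split: if_splits)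
  ultimately show "set (arcs U) \<subseteq> R U"
    by (auto simp: arcs_def)
  have edges: "r \<in> set (arcs U)" if "p \<in> set es" "r \<in> set (edge_arcs U p)" for p r
    using that by (auto simp: arcs_def)
  have vertices: "r \<in> set (arcs U)" if "v \<in> U" "r \<in> set (vertex_arcs U v)" for v r
    using that vs(2) assms by (auto simp: arcs_def)
  show "R U \<subseteq> set (arcs U)"
  proof
    fix r assume "r \<in> R U"
    then show "r \<in> set (arcs U)"
    proof (cases rule: residual_arc_cases)
      case (add a b)
      then obtain p where p: "p \<in> set es" "uedge p = {a, b}" using es(2) by (metis imageE)
      \<comment> \<open>The stored orientation is arbitrary, but \<open>edge_arcs\<close> contains
        both lifts.\<close>
      then have "p = (a, b) \<or> p = (b, a)"
        by (cases p) (auto simp: uedge_def doubleton_eq_iff)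
      then show ?thesis
        using add p by (intro edges[OF p(1)]) (auto simp: edge_arcs_def Let_def)
    next
      case (del a b)
      then have "{a, b} \<in> E" using M_sub by blast
      then obtain p where p: "p \<in> set es" "uedge p = {a, b}" using es(2) by (metis imageE)
      then have "p = (a, b) \<or> p = (b, a)"
        by (cases p) (auto simp: uedge_def doubleton_eq_iff)
      then show ?thesis
        using del p by (intro edges[OF p(1)]) (auto simp: edge_arcs_def Let_def)
    qed (auto intro!: vertices simp: vertex_arcs_def)
  qed
qed

definition input :: "state \<Rightarrow> bool" where
  "input s \<longleftrightarrow> fst s 0 0 = length vs \<and> fst s 0 1 = length es \<and>
     (\<forall>i<length vs. fst s 1 i = vs ! i \<and> fst s 2 i = c (vs ! i)) \<and>
     (\<forall>j<length es. fst s 3 j = fst (es ! j) \<and> fst s 4 j = snd (es ! j) \<and>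
        fst s 5 j = of_bool (uedge (es ! j) \<in> M) \<and> snd s 0 j = w (uedge (es ! j)))"

text \<open>Only positivity of the presence flag is fixed: it starts as a degree and is 1 during the
  test of a candidate.\<close>

definition ready :: "nat set \<Rightarrow> state \<Rightarrow> bool" where
  "ready U s \<longleftrightarrow> input s \<and>
     (\<forall>v\<in>V. fst s 8 v = c v \<and> fst s 9 v = mdeg M v \<and> (0 < fst s 10 v \<longleftrightarrow> v \<in> U))"

lemma ready_unchanged: "ready U s \<Longrightarrow> unchanged {12, 13, 14} s s' \<Longrightarrow> ready U s'"
  by (simp add: ready_def input_def unchanged_def)

lemma run_edge_com:
  assumes "ready U s" "fst s 13 0 = j" "j < length es"
  shows "pass_state (run edge_com s) = fold relax (edge_arcs U (es ! j)) (pass_state s)"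
    and "unchanged {14} s (run edge_com s)"
proof -
  let ?a = "NCell 3 (counter 13)" and ?b = "NCell 4 (counter 13)" and ?g = "RCell 0 (counter 13)"
  have vals: "nval ?a s' = fst (es ! j)" "nval ?b s' = snd (es ! j)"
    "rval ?g s' = w (uedge (es ! j))" if "unchanged {14} s s'" for s'
    using assms that by (auto simp: ready_def input_def unchanged_def)
  have cond: "fst (es ! j) \<in> U \<longleftrightarrow> 0 < nval (NCell 10 ?a) s"
    "snd (es ! j) \<in> U \<longleftrightarrow> 0 < nval (NCell 10 ?b) s"
    "uedge (es ! j) \<in> M \<longleftrightarrow> 0 < nval (NCell 5 (counter 13)) s"
    using assms nth_es[of j] by (auto simp: ready_def input_def)
  define h where "h i = (if i = ?a then fst (es ! j) else snd (es ! j))" for i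
  have h: "h ?a = fst (es ! j)" "h ?b = snd (es ! j)" by (auto simp: h_def)
  have h': "nval i s' = h i" if "unchanged {14} s s'" "i \<in> {?a, ?b}" for i s'
    using vals[OF that(1)] that(2) h by auto
  have G: "rval (RSub r ?g) s' = rval r s' + - w (uedge (es ! j))"
    "rval (RAdd r ?g) s' = rval r s' + w (uedge (es ! j))" if "unchanged {14} s s'" for r s'
    using vals(3)[OF that] by simp_all
  let ?del = "Seq (relax_com (Neg ?a) (\<lambda>r. RSub r ?g) (Pos ?b)) (relax_com (Neg ?b) (\<lambda>r. RSub r ?g) (Pos ?a))"
  let ?add = "Seq (relax_com (Pos ?a) (\<lambda>r. RAdd r ?g) (Neg ?b)) (relax_com (Pos ?b) (\<lambda>r. RAdd r ?g) (Neg ?a))"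
  have "pass_state (run ?del s) = fold relax
      [(map_node h (Neg ?a), - w (uedge (es ! j)), map_node h (Pos ?b)),
       (map_node h (Neg ?b), - w (uedge (es ! j)), map_node h (Pos ?a))] (pass_state s)"
    by (rule run_relax_pair(1)[OF G(1)], assumption, erule h', force)
  moreover have "unchanged {14} s (run ?del s)"
    by (rule run_relax_pair(2)[OF G(1)], assumption, erule h', force)
  moreover have "pass_state (run ?add s) = fold relax
      [(map_node h (Pos ?a), w (uedge (es ! j)), map_node h (Neg ?b)),
       (map_node h (Pos ?b), w (uedge (es ! j)), map_node h (Neg ?a))] (pass_state s)"
    by (rule run_relax_pair(1)[OF G(2)], assumption, erule h', force)
  moreover have "unchanged {14} s (run ?add s)"
    by (rule run_relax_pair(2)[OF G(2)], assumption, erule h', force)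
  moreover have "run edge_com s = (if fst (es ! j) \<in> U \<and> snd (es ! j) \<in> U
      then if uedge (es ! j) \<in> M then run ?del s else run ?add s else s)"
    unfolding edge_com_def Let_def cond run.simps(5) bval.simps bval_positive run.simps(1) ..
  ultimately show "pass_state (run edge_com s) = fold relax (edge_arcs U (es ! j)) (pass_state s)"
    "unchanged {14} s (run edge_com s)"
    using h by (simp_all add: edge_arcs_def Let_def del: fold_simps run.simps)
qed

lemma run_vertex_com:
  assumes "ready U s" "fst s 13 0 = i" "i < length vs"
  shows "pass_state (run vertex_com s) = fold relax (vertex_arcs U (vs ! i)) (pass_state s)"
    and "unchanged {14} s (run vertex_com s)"
proof -
  let ?v = "NCell 1 (counter 13)"
  define A where "A = Cond (NLess (NCell 9 ?v) (NCell 8 ?v))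
    (Seq (relax_com Root (\<lambda>r. r) (Pos ?v)) (relax_com (Neg ?v) (\<lambda>r. r) Root)) Skip"
  define B where "B = Cond (positive (NCell 9 ?v))
    (Seq (relax_com (Pos ?v) (\<lambda>r. r) Root) (relax_com Root (\<lambda>r. r) (Neg ?v))) Skip"
  have vals: "nval ?v s' = vs ! i" if "unchanged {14} s s'" for s'
    using assms that by (auto simp: ready_def input_def unchanged_def)
  have vals': "nval (NCell 9 ?v) s' = mdeg M (vs ! i)" "nval (NCell 8 ?v) s' = c (vs ! i)"
    "0 < nval (NCell 10 ?v) s' \<longleftrightarrow> vs ! i \<in> U" if "unchanged {14} s s'" for s'
    using assms that nth_vs[of i] by (auto simp: ready_def input_def unchanged_def)
  have A: "pass_state (run A s) = fold relax
      (if mdeg M (vs ! i) < c (vs ! i) then [(Root, 0, Pos (vs ! i)), (Neg (vs ! i), 0, Root)] else [])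
      (pass_state s) \<and> unchanged {14} s (run A s)"
  proof (cases "mdeg M (vs ! i) < c (vs ! i)")
    case True
    then show ?thesis
      using run_relax_pair[of s "\<lambda>r. r" 0 Root "Pos ?v" "Neg ?v" Root "\<lambda>_. vs ! i"]
      by (simp add: A_def vals vals' del: One_nat_def nval.simps(2) run.simps(4) fold_simps)
  qed (simp add: A_def vals' del: One_nat_def nval.simps(2))
  then have u: "unchanged {14} s (run A s)" ..
  have u': "unchanged {14} s s'" if "unchanged {14} (run A s) s'" for s'
    using unchanged_trans[OF u that] by simp
  have B: "pass_state (run B (run A s)) = fold relax
      (if 0 < mdeg M (vs ! i) then [(Pos (vs ! i), 0, Root), (Root, 0, Neg (vs ! i))] else [])
      (pass_state (run A s)) \<and> unchanged {14} (run A s) (run B (run A s))"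
  proof (cases "0 < mdeg M (vs ! i)")
    case True
    then show ?thesis
      using run_relax_pair[of "run A s" "\<lambda>r. r" 0 "Pos ?v" Root Root "Neg ?v" "\<lambda>_. vs ! i"]
      by (simp add: B_def vals vals' u u' del: One_nat_def nval.simps(2) run.simps(4) fold_simps)
  qed (simp add: B_def vals' u del: One_nat_def nval.simps(2))
  have eq: "run vertex_com s = (if vs ! i \<in> U then run B (run A s) else s)"
    using vals'(3)[of s] by (simp add: vertex_com_def A_def B_def Let_def del: One_nat_def nval.simps(2))
  show "pass_state (run vertex_com s) = fold relax (vertex_arcs U (vs ! i)) (pass_state s)"
    unfolding eq vertex_arcs_def using A B by (simp del: fold_simps)
  show "unchanged {14} s (run vertex_com s)"
    unfolding eq using B u' by simp
qed

lemma runs_pass_com: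
  assumes "ready U s"
  shows "runs pass_com s (pass_time (length vs) (length es))
    (\<lambda>s'. unchanged {13, 14} s s' \<and> pass_state s' = pass (arcs U) (pass_state s))"
proof -
  have ready: "ready U s'" if "unchanged {13, 14} s s'" for s'
    using ready_unchanged[OF assms unchanged_mono[OF that]] by auto
  \<comment> \<open>\<open>pass\<close> starts from a cleared flag, hence
    \<open>(labels s, False)\<close> instead of \<open>pass_state s\<close>.\<close>
  let ?P = "\<lambda>L s'. unchanged {13, 14} s s' \<and> pass_state s' = fold relax L (labels s, False)"
  let ?E = "concat (map (edge_arcs U) es)"
  have 1: "runs (NAssign 14 (NConst 0) (NConst 0)) s 1 (?P [])"
    using runs_run[of "NAssign 14 (NConst 0) (NConst 0)" "?P []" s]
    by (auto simp: unchanged_def pass_state_def)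
  have 2: "runs (for_loop 13 num_edges edge_com) s' (length es * (steps edge_com + 2) + 2)
      (?P (concat (map (edge_arcs U) (take (length es) es))))" if "?P [] s'" for s'
  proof (rule runs_for_loop[where I = "\<lambda>j. ?P (concat (map (edge_arcs U) (take j es)))"])
    fix j s' assume P: "?P (concat (map (edge_arcs U) (take j es))) s'"
      and j: "fst s' 13 0 = j" "j < length es"
    have r: "ready U s'" using ready P by blast
    have "unchanged {13, 14} s (run edge_com s')"
      using P run_edge_com(2)[OF r j] unchanged_trans by blast
    moreover have "fst (run edge_com s') 13 0 = j"
      using run_edge_com(2)[OF r j] j by (auto simp: unchanged_def)
    ultimately show "runs edge_com s' (steps edge_com)
      (\<lambda>s'. ?P (concat (map (edge_arcs U) (take (Suc j) es))) s' \<and> fst s' 13 0 = j)"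
      using P run_edge_com(1)[OF r j] j(2)
      by (intro runs_run) (auto simp: take_Suc_conv_app_nth edge_com_def Let_def)
  qed (use that ready in \<open>auto simp: pass_state_counter unchanged_counter ready_def input_def\<close>)
  have 3: "runs (for_loop 13 num_vertices vertex_com) s' (length vs * (steps vertex_com + 2) + 2)
      (?P (?E @ concat (map (vertex_arcs U) (take (length vs) vs))))" if "?P ?E s'" for s'
  proof (rule runs_for_loop[where I = "\<lambda>i. ?P (?E @ concat (map (vertex_arcs U) (take i vs)))"])
    fix i s' assume P: "?P (?E @ concat (map (vertex_arcs U) (take i vs))) s'"
      and i: "fst s' 13 0 = i" "i < length vs"
    have r: "ready U s'" using ready P by blast
    have "unchanged {13, 14} s (run vertex_com s')"
      using P run_vertex_com(2)[OF r i] unchanged_trans by blast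
    moreover have "fst (run vertex_com s') 13 0 = i"
      using run_vertex_com(2)[OF r i] i by (auto simp: unchanged_def)
    ultimately show "runs vertex_com s' (steps vertex_com)
      (\<lambda>s'. ?P (?E @ concat (map (vertex_arcs U) (take (Suc i) vs))) s' \<and> fst s' 13 0 = i)"
      using P run_vertex_com(1)[OF r i] i(2)
      by (intro runs_run) (auto simp: take_Suc_conv_app_nth vertex_com_def Let_def)
  qed (use that ready in \<open>auto simp: pass_state_counter unchanged_counter ready_def input_def\<close>)
  show ?thesis
    unfolding pass_com_def pass_time_def
  proof (rule runs_Seq[OF 1], rule runs_Seq)
    fix s' assume "?P [] s'"
    then show "runs (for_loop 13 num_edges edge_com) s' (length es * (steps edge_com + 2) + 2) (?P ?E)"
      using 2 by simp
  next
    fix s' assume "?P ?E s'"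
    from 3[OF this] show "runs (for_loop 13 num_vertices vertex_com) s'
        (length vs * (steps vertex_com + 2) + 2)
        (\<lambda>s'. unchanged {13, 14} s s' \<and> pass_state s' = pass (arcs U) (pass_state s))"
      by (rule runs_weaken) (auto simp: pass_def arcs_def pass_state_def)
  qed
qed

lemma runs_test_com:
  assumes "ready U s" "U \<subseteq> V"
  shows "runs test_com s (test_time (length vs) (length es))
    (\<lambda>s'. unchanged {12, 13, 14} s s' \<and> (0 < fst s' 14 0 \<longleftrightarrow> \<not> no_gainful_cycle (R U)))"
proof -
  let ?P = "\<lambda>k s'. unchanged {12, 13, 14} s s' \<and>
    pass_state s' = (pass (arcs U) ^^ k) (pass_state s)"
  \<comment> \<open>\<open>?X\<close> holds the nodes of all vertices, present or not, so one number
    of sweeps serves every \<open>U\<close>.\<close>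
  let ?N = "length vs + length vs + 1" and ?X = "insert Root (Pos ` V \<union> Neg ` V)"
  have ready: "ready U s'" if "unchanged {12, 13, 14} s s'" for s'
    using ready_unchanged[OF assms(1) that] .
  have runs: "runs test_com s (test_time (length vs) (length es)) (?P ?N)"
    unfolding test_com_def test_time_def
  proof (rule runs_for_loop)
    fix k s' assume P: "?P k s'" and k: "fst s' 12 0 = k"
    from runs_pass_com[OF ready] P
    have "runs pass_com s' (pass_time (length vs) (length es))
      (\<lambda>s''. unchanged {13, 14} s' s'' \<and> pass_state s'' = pass (arcs U) (pass_state s'))" by blast
    then show "runs pass_com s' (pass_time (length vs) (length es)) (\<lambda>s'. ?P (Suc k) s' \<and> fst s' 12 0 = k)"
    proof (rule runs_weaken)
      fix s'' assume "unchanged {13, 14} s' s'' \<and> pass_state s'' = pass (arcs U) (pass_state s')"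
      moreover from this have "unchanged {12, 13, 14} s s''"
        using unchanged_trans[of "{12, 13, 14}" s s' "{13, 14}" s''] P by auto
      ultimately show "?P (Suc k) s'' \<and> fst s'' 12 0 = k"
        using P k by (auto simp: unchanged_def)
    qed simp
  qed (use ready in \<open>auto simp: pass_state_counter unchanged_counter ready_def input_def\<close>)
  have flag: "\<not> snd ((pass (arcs U) ^^ ?N) (pass_state s)) \<longleftrightarrow> no_gainful_cycle (R U)"
  proof -
    have "card ?X \<le> Suc (card (Pos ` V \<union> Neg ` V))"
      by (simp add: card_insert_le_m1)
    also have "card (Pos ` V \<union> Neg ` V) \<le> card (Pos ` V) + card (Neg ` V)"
      by (rule card_Un_le)
    also have "card (Pos ` V) + card (Neg ` V) \<le> length vs + length vs"
      using card_image_le[OF finite_V, of Pos] card_image_le[OF finite_V, of Neg]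
        distinct_card[OF vs(1)] vs(2) by simp
    finally have "card ?X \<le> Suc (length vs + length vs)" by simp
    moreover have "\<forall>(x, g, y)\<in>set (arcs U). x \<in> ?X \<and> y \<in> ?X"
    proof (clarify)
      fix x g y assume "(x, g, y) \<in> set (arcs U)"
      then have "arc_verts (x, g, y) \<subseteq> V"
        using residual_verts[of "(x, g, y)"] set_arcs[OF assms(2)] assms(2) by blast
      then show "x \<in> ?X \<and> y \<in> ?X"
        by (cases x; cases y) (auto simp: arc_verts_def)
    qed
    ultimately show ?thesis
      using passes_flag_iff[of ?X "arcs U" "length vs + length vs" "pass_state s"]
        set_arcs[OF assms(2)] finite_V by simp
  qed
  show ?thesis
  proof (rule runs_weaken[OF runs order_refl])
    fix s' assume P: "?P ?N s'"
    then have eq: "pass_state s' = (pass (arcs U) ^^ ?N) (pass_state s)" ..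
    have "snd (pass_state s') \<longleftrightarrow> \<not> no_gainful_cycle (R U)"
      unfolding eq using flag by blast
    then show "unchanged {12, 13, 14} s s' \<and> (0 < fst s' 14 0 \<longleftrightarrow> \<not> no_gainful_cycle (R U))"
      using P by (simp add: pass_state_def)
  qed
qed

lemma input_init_state: "input (init_state vs es w c M)"
  by (auto simp: input_def init_state_def array_of_def)

definition deg_upto :: "nat \<Rightarrow> nat \<Rightarrow> nat" where
  "deg_upto j v = length (filter (\<lambda>p. uedge p \<in> M \<and> v \<in> uedge p) (take j es))"

text \<open>Each edge is stored once, whatever its orientation, so counting list entries counts
  edges.\<close>

lemma deg_upto_all: "deg_upto (length es) v = mdeg M v"
proof -
  let ?F = "filter (\<lambda>p. uedge p \<in> M \<and> v \<in> uedge p) es"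
  have "distinct (map uedge ?F)" using es(1) by (rule distinct_map_filter)
  then have "length ?F = card (set (map uedge ?F))" using distinct_card by fastforce
  also have "set (map uedge ?F) = {e \<in> M. v \<in> e}" using es(2) M_sub by auto
  finally show ?thesis by (simp add: deg_upto_def mdeg_def)
qed

lemma runs_setup_com:
  defines "s \<equiv> init_state vs es w c M"
  shows "runs setup_com s (setup_time (length vs) (length es))
    (\<lambda>s'. ready covered s' \<and> fst s' 6 0 = 0 \<and> (\<forall>i. fst s' 7 i = 0))"
proof -
  let ?Z = "\<lambda>s'. \<forall>i. fst s' 6 i = 0 \<and> fst s' 7 i = 0"
  let ?P = "\<lambda>i s'. input s' \<and> ?Z s' \<and> (\<forall>v. fst s' 9 v = 0) \<and> (\<forall>k<i. fst s' 8 (vs ! k) = c (vs ! k))"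
  let ?Q = "\<lambda>j s'. input s' \<and> ?Z s' \<and> (\<forall>v\<in>V. fst s' 8 v = c v) \<and> (\<forall>v. fst s' 9 v = deg_upto j v)"
  let ?S = "\<lambda>i s'. input s' \<and> ?Z s' \<and> (\<forall>v\<in>V. fst s' 8 v = c v) \<and> (\<forall>v. fst s' 9 v = mdeg M v) \<and>
    (\<forall>k<i. fst s' 10 (vs ! k) = mdeg M (vs ! k))"
  have counter: "input (upd (fst s) 13 0 x, snd s)" if "input s" for s x
    using that by (simp add: input_def)
  have 1: "runs (for_loop 13 num_vertices capacity_com) s (length vs * (1 + 2) + 2) (?P (length vs))"
  proof (rule runs_for_loop)
    show "?P 0 s" using input_init_state by (simp add: s_def init_state_def)
    fix i s' assume P: "?P i s'" and i: "fst s' 13 0 = i" "i < length vs"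
    have "runs capacity_com s' (steps capacity_com) (\<lambda>s'. ?P (Suc i) s' \<and> fst s' 13 0 = i)"
    proof (rule runs_run)
      show "?P (Suc i) (run capacity_com s') \<and> fst (run capacity_com s') 13 0 = i"
        using P i by (auto simp: capacity_com_def input_def less_Suc_eq)
    qed (simp add: capacity_com_def)
    then show "runs capacity_com s' 1 (\<lambda>s'. ?P (Suc i) s' \<and> fst s' 13 0 = i)"
      by (simp add: capacity_com_def)
  qed (auto simp: counter, auto simp: input_def)
  have 2: "runs (for_loop 13 num_edges degree_com) s' (length es * (steps degree_com + 2) + 2) (?Q (length es))"
    if "?P (length vs) s'" for s'
  proof (rule runs_for_loop)
    have "fst s' 8 v = c v" if "v \<in> V" for v
      using \<open>?P (length vs) s'\<close> that vs(2) by (metis in_set_conv_nth)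
    then show "?Q 0 s'" using that by (simp add: deg_upto_def)
    fix j s' assume Q: "?Q j s'" and j: "fst s' 13 0 = j" "j < length es"
    show "runs degree_com s' (steps degree_com) (\<lambda>s'. ?Q (Suc j) s' \<and> fst s' 13 0 = j)"
    proof (rule runs_run)
      have "deg_upto (Suc j) v = deg_upto j v + of_bool (uedge (es ! j) \<in> M \<and> v \<in> uedge (es ! j))" for v
        using j(2) by (simp add: deg_upto_def take_Suc_conv_app_nth)
      \<comment> \<open>The endpoints differ, so the two increments hit different cells.\<close>
      then show "?Q (Suc j) (run degree_com s') \<and> fst (run degree_com s') 13 0 = j"
        using Q j nth_es(4)[OF j(2)] by (auto simp: degree_com_def Let_def input_def uedge_def)
    qed (simp add: degree_com_def Let_def)
  qed (auto simp: counter, auto simp: input_def)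
  have 3: "runs (for_loop 13 num_vertices present_com) s' (length vs * (1 + 2) + 2) (?S (length vs))"
    if "?Q (length es) s'" for s'
  proof (rule runs_for_loop)
    show "?S 0 s'" using that by (simp add: deg_upto_all)
    fix i s' assume S: "?S i s'" and i: "fst s' 13 0 = i" "i < length vs"
    have "runs present_com s' (steps present_com) (\<lambda>s'. ?S (Suc i) s' \<and> fst s' 13 0 = i)"
    proof (rule runs_run)
      show "?S (Suc i) (run present_com s') \<and> fst (run present_com s') 13 0 = i"
        using S i by (auto simp: present_com_def input_def less_Suc_eq)
    qed (simp add: present_com_def)
    then show "runs present_com s' 1 (\<lambda>s'. ?S (Suc i) s' \<and> fst s' 13 0 = i)"
      by (simp add: present_com_def)
  qed (auto simp: counter, auto simp: input_def)
  have "runs setup_com s (setup_time (length vs) (length es)) (?S (length vs))"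
    unfolding setup_com_def setup_time_def
    by (rule runs_Seq[OF 1], rule runs_Seq[OF 2], assumption, rule 3)
  then show ?thesis
  proof (rule runs_weaken[OF _ order_refl])
    fix s' assume S: "?S (length vs) s'"
    then have "fst s' 10 v = mdeg M v" if "v \<in> V" for v
      using that vs(2) by (metis in_set_conv_nth)
    then show "ready covered s' \<and> fst s' 6 0 = 0 \<and> (\<forall>i. fst s' 7 i = 0)"
      using S by (auto simp: ready_def covered_def)
  qed
qed

text \<open>Entries from \<open>i\<close> on must already be 0, since the loop body writes nothing
  for a covered vertex.\<close>

definition listed :: "nat \<Rightarrow> state \<Rightarrow> bool" where
  "listed i s \<longleftrightarrow> ready covered s \<and> fst s 6 0 = 1 \<and>
     (\<forall>k<length vs. 0 < fst s 7 k \<longleftrightarrow> k < i \<and> vs ! k \<in> forced)"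

lemma runs_candidate_com:
  assumes l: "listed i s" and i: "fst s 11 0 = i" "i < length vs"
  shows "runs candidate_com s (candidate_time (length vs) (length es))
    (\<lambda>s'. listed (Suc i) s' \<and> fst s' 11 0 = i)"
proof -
  let ?v = "NCell 1 (counter 11)"
  have r: "ready covered s" and v: "vs ! i \<in> V" using l nth_vs[OF i(2)] by (auto simp: listed_def)
  have val: "nval ?v s = vs ! i" "nval (NCell 9 ?v) s = mdeg M (vs ! i)"
    using r v i by (auto simp: ready_def input_def)
  show ?thesis
    unfolding candidate_com_def candidate_time_def Let_def
  proof (rule runs_Cond)
    assume "bval (positive (NCell 9 ?v)) s"
    then have "vs ! i \<notin> forced"
      using val v by (auto simp: forced_def covered_def simp del: nval.simps(2) One_nat_def)
    then have "listed (Suc i) s" using l by (auto simp: listed_def less_Suc_eq)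
    then have "runs Skip s (steps Skip) (\<lambda>s'. listed (Suc i) s' \<and> fst s' 11 0 = i)"
      using i by (intro runs_run) auto
    then show "runs Skip s (1 + (test_time (length vs) (length es) + 2))
        (\<lambda>s'. listed (Suc i) s' \<and> fst s' 11 0 = i)"
      by (rule runs_weaken) auto
  next
    assume "\<not> bval (positive (NCell 9 ?v)) s"
    then have nc: "vs ! i \<notin> covered"
      using val by (auto simp: covered_def simp del: nval.simps(2) One_nat_def)
    let ?U = "insert (vs ! i) covered"
    let ?s = "(upd (fst s) 10 (vs ! i) 1, snd s)"
    have U: "?U \<subseteq> V" using v covered_sub by auto
    have r': "ready ?U ?s" using r v by (auto simp: ready_def input_def)
    have A: "runs (NAssign 10 ?v (NConst 1)) s 1 (\<lambda>s'. s' = ?s)"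
      using runs_run[of "NAssign 10 ?v (NConst 1)" "\<lambda>s'. s' = ?s" s] val(1)
      by (simp del: nval.simps(2) One_nat_def)
    let ?t = "\<lambda>s'. unchanged {12, 13, 14} ?s s' \<and> (0 < fst s' 14 0 \<longleftrightarrow> vs ! i \<in> forced)"
    have B: "runs test_com ?s (test_time (length vs) (length es)) ?t"
      using runs_test_com[OF r' U] v nc by (simp add: forced_def)
    have C: "runs (Seq (NAssign 7 (counter 11) (counter 14)) (NAssign 10 ?v (NConst 0))) s' 2
      (\<lambda>s'. listed (Suc i) s' \<and> fst s' 11 0 = i)" if t: "?t s'" for s'
    proof -
      let ?q = "Seq (NAssign 7 (counter 11) (counter 14)) (NAssign 10 ?v (NConst 0))"
      have n: "fst s' a = fst ?s a" if "a \<notin> {12, 13, 14}" for a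
        using t that by (auto simp: unchanged_def)
      have ready: "ready ?U s'" using ready_unchanged[OF r'] t by blast
      have c11: "fst s' 11 0 = i" using n[of 11] i by simp
      have vi: "fst s' 1 i = vs ! i" using ready i by (auto simp: ready_def input_def)
      have run: "run ?q s' = (upd (upd (fst s') 7 i (fst s' 14 0)) 10 (vs ! i) 0, snd s')"
        using c11 vi by simp
      \<comment> \<open>Clearing the flag leaves exactly \<open>covered\<close>, because the
        candidate is exposed.\<close>
      have "ready covered (run ?q s')"
        unfolding run using ready nc by (auto simp: ready_def input_def)
      moreover have "fst (run ?q s') 6 0 = 1"
        unfolding run using n[of 6] l by (simp add: listed_def)
      moreover have "0 < fst (run ?q s') 7 k \<longleftrightarrow> k < Suc i \<and> vs ! k \<in> forced" if "k < length vs" for k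
        unfolding run using n[of 7] l t that by (auto simp: listed_def less_Suc_eq)
      moreover have "fst (run ?q s') 11 0 = i"
        unfolding run using c11 by simp
      ultimately have "listed (Suc i) (run ?q s') \<and> fst (run ?q s') 11 0 = i"
        by (simp add: listed_def)
      then have "runs ?q s' (steps ?q) (\<lambda>s'. listed (Suc i) s' \<and> fst s' 11 0 = i)"
        by (intro runs_run) auto
      then show ?thesis by (rule runs_weaken) auto
    qed
    show "runs (Seq (NAssign 10 ?v (NConst 1)) (Seq test_com
        (Seq (NAssign 7 (counter 11) (counter 14)) (NAssign 10 ?v (NConst 0))))) s
        (1 + (test_time (length vs) (length es) + 2)) (\<lambda>s'. listed (Suc i) s' \<and> fst s' 11 0 = i)"
    proof (rule runs_Seq[OF A])
      fix s' assume "s' = ?s"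
      then show "runs (Seq test_com
        (Seq (NAssign 7 (counter 11) (counter 14)) (NAssign 10 ?v (NConst 0)))) s'
        (test_time (length vs) (length es) + 2) (\<lambda>s'. listed (Suc i) s' \<and> fst s' 11 0 = i)"
        using runs_Seq[OF B C] by blast
    qed
  qed
qed

theorem runs_main_com:
  "runs main_com (init_state vs es w c M) (main_time (length vs) (length es))
    (\<lambda>s. if output_found s then min_M_vertex_stabilizer V E w c M (output_set vs s)
      else (\<nexists>S. M_vertex_stabilizer V E w c M S))"
  (is "runs _ _ _ ?post")
proof -
  let ?n = "length vs" and ?m = "length es"
  let ?fresh = "\<lambda>s. ready covered s \<and> fst s 6 0 = 0 \<and> (\<forall>i. fst s 7 i = 0)"
  let ?tested = "\<lambda>s. ?fresh s \<and> (0 < fst s 14 0 \<longleftrightarrow> \<not> no_gainful_cycle (R covered))"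
  have test: "runs test_com s (test_time ?n ?m) ?tested" if "?fresh s" for s
  proof (rule runs_weaken[OF runs_test_com order_refl])
    fix s' assume "unchanged {12, 13, 14} s s' \<and> (0 < fst s' 14 0 \<longleftrightarrow> \<not> no_gainful_cycle (R covered))"
    then show "?tested s'" using that ready_unchanged[of covered s s'] by (auto simp: unchanged_def)
  qed (use that covered_sub in auto)
  have search: "runs (Cond (positive (counter 14)) Skip
      (Seq (NAssign 6 (NConst 0) (NConst 1)) (for_loop 11 num_vertices candidate_com))) s
      (1 + (?n * (candidate_time ?n ?m + 2) + 2) + 1) ?post" if s: "?tested s" for s
  proof (rule runs_Cond)
    assume "bval (positive (counter 14)) s"
    then have "?post s" using s no_stabilizer by (auto simp: output_found_def)
    then have "runs Skip s (steps Skip) ?post" by (intro runs_run) auto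
    then show "runs Skip s (1 + (?n * (candidate_time ?n ?m + 2) + 2)) ?post"
      by (rule runs_weaken) auto
  next
    assume "\<not> bval (positive (counter 14)) s"
    then have opt: "no_gainful_cycle (R covered)" using s by simp
    have start: "runs (NAssign 6 (NConst 0) (NConst 1)) s 1 (listed 0)"
      using runs_run[of "NAssign 6 (NConst 0) (NConst 1)" "listed 0" s] s
      by (simp add: listed_def ready_def input_def)
    have loop: "runs (for_loop 11 num_vertices candidate_com) s'
        (?n * (candidate_time ?n ?m + 2) + 2) (listed ?n)" if "listed 0 s'" for s'
      by (rule runs_for_loop[OF that _ _ runs_candidate_com])
        (auto simp: listed_def ready_def input_def)
    have post: "?post s'" if "listed ?n s'" for s'
    proof -
      have "fst s' 7 k \<noteq> 0 \<longleftrightarrow> vs ! k \<in> forced" if "k < ?n" for k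
        using \<open>listed ?n s'\<close> that by (auto simp: listed_def)
      moreover have "\<exists>k<?n. vs ! k = v" if "v \<in> forced" for v
        using that vs(2) by (auto simp: forced_def in_set_conv_nth[symmetric])
      ultimately have "output_set vs s' = forced"
        unfolding output_set_def by blast
      then show ?thesis
        using forced_minimum[OF opt] that by (auto simp: listed_def output_found_def)
    qed
    show "runs (Seq (NAssign 6 (NConst 0) (NConst 1)) (for_loop 11 num_vertices candidate_com)) s
      (1 + (?n * (candidate_time ?n ?m + 2) + 2)) ?post"
      by (rule runs_Seq[OF start], rule runs_weaken[OF loop order_refl], assumption, rule post)
  qed
  show ?thesis
    unfolding main_com_def main_time_def
    by (rule runs_Seq[OF runs_setup_com], rule runs_Seq[OF test], assumption, rule search)
qed

end

section \<open>Polynomial running time\<close>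

definition is_poly :: "(nat \<Rightarrow> nat) \<Rightarrow> bool" where
  "is_poly f \<longleftrightarrow> (\<exists>q. \<forall>x. poly q x = f x)"

lemma is_poly_intros:
  "is_poly (\<lambda>x. k)" "is_poly (\<lambda>x. x)"
  "is_poly f \<Longrightarrow> is_poly g \<Longrightarrow> is_poly (\<lambda>x. f x + g x)"
  "is_poly f \<Longrightarrow> is_poly g \<Longrightarrow> is_poly (\<lambda>x. f x * g x)"
proof -
  show "is_poly (\<lambda>x. k)" unfolding is_poly_def by (rule exI[of _ "[:k:]"]) simp
  show "is_poly (\<lambda>x. x)" unfolding is_poly_def by (rule exI[of _ "[:0, 1:]"]) simp
  show "is_poly f \<Longrightarrow> is_poly g \<Longrightarrow> is_poly (\<lambda>x. f x + g x)"
    unfolding is_poly_def by (metis poly_add)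
  show "is_poly f \<Longrightarrow> is_poly g \<Longrightarrow> is_poly (\<lambda>x. f x * g x)"
    unfolding is_poly_def by (metis poly_mult)
qed

lemma length_le_sum_list: "length xs \<le> (\<Sum>x\<leftarrow>xs. 1 + f x + g x :: nat)"
  by (induction xs) auto

lemma main_time_mono:
  assumes "n \<le> x" "m \<le> x"
  shows "main_time n m \<le> main_time x x"
  unfolding main_time_def candidate_time_def setup_time_def test_time_def pass_time_def
  by (intro add_mono mult_mono order_refl assms zero_le)

lemma is_poly_main_time: "is_poly (\<lambda>x. main_time x x)"
  unfolding main_time_def candidate_time_def setup_time_def test_time_def pass_time_def
  by (intro is_poly_intros)

theorem theorem4:
  shows "\<exists>(prog :: com) (q :: nat poly).
    \<forall>(V :: nat set) (E :: nat set set) (w :: nat set \<Rightarrow> real) (c :: nat \<Rightarrow> nat) (M :: nat set set)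
      (vs :: nat list) (es :: (nat \<times> nat) list).
      simple_graph V E \<and> (\<forall>e\<in>E. 0 \<le> w e) \<and> max_weight_c_matching V E w c M \<and>
      represents vs es V E \<longrightarrow>
      (\<exists>t s. exec prog (init_state vs es w c M) t s \<and>
             t \<le> poly q (input_size vs es c) \<and>
             (if output_found s
              then min_M_vertex_stabilizer V E w c M (output_set vs s)
              else (\<nexists>S. M_vertex_stabilizer V E w c M S)))"
proof -
  obtain q where q: "\<And>x. poly q x = main_time x x"
    using is_poly_main_time by (auto simp: is_poly_def)
  have "\<exists>t s. exec main_com (init_state vs es w c M) t s \<and> t \<le> poly q (input_size vs es c) \<and>
      (if output_found s then min_M_vertex_stabilizer V E w c M (output_set vs s)
       else (\<nexists>S. M_vertex_stabilizer V E w c M S))"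
    if "simple_graph V E" "max_weight_c_matching V E w c M" "represents vs es V E"
    for V E w c M vs es
  proof -
    interpret encoded_graph V E w c M vs es
      using that by unfold_locales
    \<comment> \<open>Every listed vertex and edge contributes at least one unit to
      \<open>input_size\<close>, so \<open>main_time\<close> on the diagonal bounds the
      cost.\<close>
    have "length vs \<le> input_size vs es c" "length es \<le> input_size vs es c"
      unfolding input_size_def by (rule trans_le_add1 trans_le_add2, rule length_le_sum_list)+
    then have "main_time (length vs) (length es) \<le> poly q (input_size vs es c)"
      unfolding q by (rule main_time_mono)
    then show ?thesis
      using runs_main_com unfolding runs_def by (meson le_trans)
  qed
  then show ?thesis by blast
qed

end
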